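(* Let $D_1\subset D_2$ be domains in $\mathbb{C}$. Assume that $D_2\setminus D_1$ has a density point (that is, an accumulation point) in $D_2$. Then there exists a holomorphic function $f$ on $D_1$ whose domain of existence is $D_1$ such that the graph $\Gamma_f=\{(z,f(z)): z\in D_1\}$ of $f$ over $D_1$ is not complete pluripolar in $D_2\times\mathbb{C}$.
   Context: A domain is a nonempty connected open set. For an open set $\Omega\subset\mathbb{C}^2$, a set $E\subset\Omega$ is called complete pluripolar in $\Omega$ if there exists a plurisubharmonic function $u$ on $\Omega$ such that $E=\{z\in\Omega: u(z)=-\infty\}$. A density point of a set $S\subset\mathbb{C}$ means a point $p$ each of whose neighbourhoods contains infinitely many points of $S$. A domain $D\subset\mathbb{C}$ is the domain of existence of a holomorphic function $f$ on $D$ if $f$ is nowhere holomorphically extendible across $\partial D$, i.e. for every $z_0\in D$ the Taylor series of $f$ at $z_0$ has radius of convergence equal to $\operatorname{dist}(z_0,\partial D)$. *)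

theory Defs
  imports "HOL-Complex_Analysis.Complex_Analysis"
begin

definition is_domain :: "complex set \<Rightarrow> bool" where
  "is_domain D \<longleftrightarrow> D \<noteq> {} \<and> connected D \<and> open D"

definition density_point :: "complex \<Rightarrow> complex set \<Rightarrow> bool" where
  "density_point p S \<longleftrightarrow> (\<forall>U. open U \<and> p \<in> U \<longrightarrow> infinite (U \<inter> S))"

(* The function may be arbitrary outside S; on S it takes values in [-\<infinity>, \<infinity>). *)
definition usc_on :: "'a::topological_space set \<Rightarrow> ('a \<Rightarrow> ereal) \<Rightarrow> bool" where
  "usc_on S u \<longleftrightarrow>
     (\<forall>x\<in>S. u x < \<infinity>) \<and> (\<forall>c. openin (top_of_set S) {x\<in>S. u x < c})"

(* Lebesgue integral of an extended-real-valued function, as the integral of its positive part minus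
   that of its negative part; e2ennreal sends negative values to 0, so it takes the positive part.
   Below it is applied to functions that are bounded above on a finite measure space, where the
   first integral is finite and the difference is never of the form \<infinity> - \<infinity>. *)
definition ereal_integral :: "'a measure \<Rightarrow> ('a \<Rightarrow> ereal) \<Rightarrow> ereal" where
  "ereal_integral M u =
     enn2ereal (\<integral>\<^sup>+ x. e2ennreal (u x) \<partial>M) - enn2ereal (\<integral>\<^sup>+ x. e2ennreal (- u x) \<partial>M)"

definition circle_mean :: "(complex \<Rightarrow> ereal) \<Rightarrow> complex \<Rightarrow> real \<Rightarrow> ereal" where
  "circle_mean u a r =
     ereal (1 / (2 * pi)) *
       ereal_integral (restrict_space lborel {0..2 * pi}) (\<lambda>t. u (a + of_real r * cis t))"

(* The constant -\<infinity> is allowed, as is usual when restricting plurisubharmonic functions to lines. *)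
definition subharmonic_on :: "complex set \<Rightarrow> (complex \<Rightarrow> ereal) \<Rightarrow> bool" where
  "subharmonic_on G u \<longleftrightarrow>
     usc_on G u \<and> (\<forall>a r. 0 < r \<and> cball a r \<subseteq> G \<longrightarrow> u a \<le> circle_mean u a r)"

definition complex_line :: "complex \<times> complex \<Rightarrow> complex \<times> complex \<Rightarrow> complex \<Rightarrow> complex \<times> complex" where
  "complex_line a b l = (fst a + l * fst b, snd a + l * snd b)"

definition plurisubharmonic_on ::
    "(complex \<times> complex) set \<Rightarrow> (complex \<times> complex \<Rightarrow> ereal) \<Rightarrow> bool" where
  "plurisubharmonic_on \<Omega> u \<longleftrightarrow>
     usc_on \<Omega> u \<and>
     (\<forall>a b. subharmonic_on {l. complex_line a b l \<in> \<Omega>} (\<lambda>l. u (complex_line a b l)))"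

definition complete_pluripolar ::
    "(complex \<times> complex) set \<Rightarrow> (complex \<times> complex) set \<Rightarrow> bool" where
  "complete_pluripolar E \<Omega> \<longleftrightarrow>
     (\<exists>u. plurisubharmonic_on \<Omega> u \<and> E = {z\<in>\<Omega>. u z = -\<infinity>})"

(* The infimum is the distance from z0 to the boundary; it is \<infinity> when the boundary is empty,
   that is, when D is the whole plane (infdist would give 0 there). *)
definition domain_of_existence :: "complex set \<Rightarrow> (complex \<Rightarrow> complex) \<Rightarrow> bool" where
  "domain_of_existence D f \<longleftrightarrow>
     is_domain D \<and> f holomorphic_on D \<and>
     (\<forall>z0\<in>D. fps_conv_radius (fps_expansion f z0) = (INF w\<in>frontier D. ereal (dist z0 w)))"

definition graph_over :: "complex set \<Rightarrow> (complex \<Rightarrow> complex) \<Rightarrow> (complex \<times> complex) set" where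
  "graph_over D f = {(z, f z) | z. z \<in> D}"

end

theory Submission
  imports Defs
begin

text \<open>
  Write \<open>f z = (\<Sum>k. c k / (z - a k))\<close> with simple poles \<open>a k\<close> on the frontier of \<open>D1\<close> and positive,
  very small residues \<open>c k\<close>. The poles accumulate at a point \<open>p \<in> D2\<close> of the frontier but avoid \<open>p\<close>,
  and the residues are so small that the series still converges at \<open>p\<close>. Then \<open>(p, f p)\<close> lies in
  \<open>D2 \<times> UNIV\<close> but not on the graph over \<open>D1\<close>, and the claim is that every plurisubharmonic
  function that is -\<infinity> on the graph is -\<infinity> at \<open>(p, f p)\<close> as well.

  The reason is a two-constants estimate that is uniform in the number of poles. Near \<open>p\<close> choose
  \<open>q \<in> D1\<close> and a small circle around \<open>q\<close> inside \<open>D1\<close>. Replace \<open>f\<close> by a partial sum of the series,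
  corrected by a constant so that its value at \<open>p\<close> is \<open>f p\<close>. Its graph is a holomorphic curve over a
  disc with finitely many tiny discs around poles removed; there the partial sum is bounded, so \<open>u\<close> is
  bounded above on the curve by a constant, and it is below any prescribed \<open>- M\<close> over the small circle
  once the partial sum is close to \<open>f\<close>. The removed discs are so small that the harmonic measure of
  the circle as seen from \<open>p\<close> stays bounded below (\<open>exists_small_pole_weights\<close> builds an explicit
  logarithmic barrier), hence \<open>u (p, f p)\<close> is at most a constant minus a fixed positive multiple of
  \<open>M\<close>. This is \<open>psh_minus_infinity_propagates\<close>.

  The estimate needs the maximum principle for \<open>u\<close> along a holomorphic curve, whereas
  plurisubharmonicity is a condition on complex lines. The lemma
  \<open>psh_on_graph_le_harmonic_majorant\<close> bridges the two by a penalisation argument: at an interior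
  maximum of \<open>u\<close> minus a smooth penalty that grows away from the curve, the sub-mean value inequality
  on the complex line in the tangent direction of the curve is violated.

  The domain of existence is \<open>D1\<close> because the poles are nearest frontier points of sufficiently many
  points of \<open>D1\<close>, and along the segment to a nearest pole that pole dominates all others
  (\<open>pole_series_domain_of_existence\<close>).
\<close>

section \<open>Upper semicontinuous functions\<close>

text \<open>
  A real constant strictly between the two values at a point separates them at all nearby points
  of \<open>S\<close>, by a defining sublevel set of \<open>u\<close> on one side and by continuity of \<open>k\<close> on the other. This is
  what lets continuous real penalties be subtracted from \<open>u\<close> below, also where \<open>u\<close> is -\<infinity>.
\<close>

lemma usc_on_less_continuous_openin:
  assumes "usc_on S u" "continuous_on S k"
  shows "openin (top_of_set S) {x\<in>S. u x < ereal (k x)}"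
proof -
  have "{x\<in>S. u x < ereal (k x)} = (\<Union>q. {x\<in>S. u x < ereal q} \<inter> {x\<in>S. k x \<in> {q<..}})"
  proof (intro equalityI subsetI)
    fix x assume "x \<in> {x\<in>S. u x < ereal (k x)}"
    then have "x \<in> S" "u x < ereal (k x)" by auto
    then obtain q where "u x < ereal q" "ereal q < ereal (k x)"
      using ereal_dense2 by blast
    with \<open>x \<in> S\<close> show "x \<in> (\<Union>q. {x\<in>S. u x < ereal q} \<inter> {x\<in>S. k x \<in> {q<..}})"
      by auto
  next
    fix x assume "x \<in> (\<Union>q. {x\<in>S. u x < ereal q} \<inter> {x\<in>S. k x \<in> {q<..}})"
    then obtain q where "x \<in> S" "u x < ereal q" "q < k x" by auto
    then show "x \<in> {x\<in>S. u x < ereal (k x)}"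
      using less_trans[of "u x" "ereal q" "ereal (k x)"] by simp
  qed
  moreover have "openin (top_of_set S) ({x\<in>S. u x < ereal q} \<inter> {x\<in>S. k x \<in> {q<..}})" for q
  proof (rule openin_Int)
    show "openin (top_of_set S) {x\<in>S. u x < ereal q}"
      using assms(1) by (simp add: usc_on_def)
    have "openin (top_of_set S) (S \<inter> k -` {q<..})"
      using assms(2) by (intro continuous_openin_preimage_gen) auto
    then show "openin (top_of_set S) {x\<in>S. k x \<in> {q<..}}"
      by (simp add: Int_def vimage_def)
  qed
  ultimately show ?thesis by (auto intro: openin_Union)
qed

lemma usc_on_minus_continuous:
  assumes "usc_on S u" "continuous_on S k"
  shows "usc_on S (\<lambda>x. u x - ereal (k x))"
  unfolding usc_on_def
proof (intro conjI ballI allI)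
  fix x assume "x \<in> S"
  then show "u x - ereal (k x) < \<infinity>"
    using assms(1) unfolding usc_on_def by (cases "u x") auto
next
  fix c :: ereal
  show "openin (top_of_set S) {x \<in> S. u x - ereal (k x) < c}"
  proof (cases c)
    case (real c')
    have "{x \<in> S. u x - ereal (k x) < c} = {x \<in> S. u x < ereal (k x + c')}"
    proof -
      have "u x - ereal (k x) < c \<longleftrightarrow> u x < ereal (k x + c')" for x
        unfolding real by (cases "u x") auto
      then show ?thesis by simp
    qed
    then show ?thesis
      using usc_on_less_continuous_openin[OF assms(1)] assms(2) by (simp add: continuous_on_add)
  next
    case PInf
    have "u x - ereal (k x) < \<infinity>" if "x \<in> S" for x
      using assms(1) that unfolding usc_on_def by (cases "u x") auto
    then have "{x \<in> S. u x - ereal (k x) < c} = S" using PInf by auto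
    then show ?thesis by simp
  next
    case MInf
    then show ?thesis by simp
  qed
qed

lemma usc_on_compose:
  assumes "usc_on S u" "continuous_on T \<phi>" "\<phi> ` T \<subseteq> S"
  shows "usc_on T (\<lambda>x. u (\<phi> x))"
  unfolding usc_on_def
proof (intro conjI ballI allI)
  fix x assume "x \<in> T"
  then show "u (\<phi> x) < \<infinity>" using assms unfolding usc_on_def by blast
next
  fix c
  have "openin (top_of_set S) {x\<in>S. u x < c}" using assms(1) by (simp add: usc_on_def)
  then have "openin (top_of_set T) (T \<inter> \<phi> -` {x\<in>S. u x < c})"
    using continuous_openin_preimage[OF assms(2)] assms(3) by blast
  moreover have "T \<inter> \<phi> -` {x\<in>S. u x < c} = {x\<in>T. u (\<phi> x) < c}" using assms(3) by auto
  ultimately show "openin (top_of_set T) {x\<in>T. u (\<phi> x) < c}" by simp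
qed

lemma usc_on_subset: "usc_on S u \<Longrightarrow> T \<subseteq> S \<Longrightarrow> usc_on T u"
  using usc_on_compose[of S u T "\<lambda>x. x"] by simp

text \<open>
  If no point were a maximum, the sets \<open>{x. u x < u y}\<close> would cover \<open>S\<close>; the largest of the
  finitely many values \<open>u y\<close> of a subcover would not be covered.
\<close>

lemma usc_on_compact_attains_sup:
  assumes "usc_on S u" "compact S" "S \<noteq> {}"
  shows "\<exists>x\<in>S. \<forall>y\<in>S. u y \<le> u x"
proof (rule ccontr)
  assume "\<not> ?thesis"
  then have ex: "\<forall>x\<in>S. \<exists>y\<in>S. u x < u y" by (auto simp: not_le)
  define B where "B = (\<lambda>y. {x\<in>S. u x < u y}) ` S"
  have "\<forall>b\<in>B. openin (top_of_set S) b" using assms(1) by (auto simp: B_def usc_on_def)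
  moreover have "S \<subseteq> \<Union>B" using ex by (auto simp: B_def)
  ultimately obtain B' where B': "B' \<subseteq> B" "finite B'" "S \<subseteq> \<Union>B'"
    using \<open>compact S\<close> unfolding compact_eq_openin_cover by meson
  then obtain Y where Y: "Y \<subseteq> S" "finite Y" "B' = (\<lambda>y. {x\<in>S. u x < u y}) ` Y"
    unfolding B_def by (meson finite_subset_image)
  have "Y \<noteq> {}" using B' Y assms(3) by auto
  then have "Max (u ` Y) \<in> u ` Y" using Y(2) by simp
  then obtain y where y: "y \<in> Y" "u y = Max (u ` Y)" by auto
  then obtain y' where "y' \<in> Y" "u y < u y'" using B' Y by blast
  moreover have "u y' \<le> u y" using y Y(2) \<open>y' \<in> Y\<close> by simp
  ultimately show False by simp
qed

lemma usc_on_compact_bounded: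
  assumes "usc_on S u" "compact S"
  obtains C :: real where "\<And>x. x \<in> S \<Longrightarrow> u x \<le> ereal C"
proof (cases "S = {}")
  case True
  then show ?thesis using that by auto
next
  case False
  then obtain x where x: "x \<in> S" "\<forall>y\<in>S. u y \<le> u x"
    using usc_on_compact_attains_sup assms by blast
  have "u x < \<infinity>" using x assms(1) by (auto simp: usc_on_def)
  then obtain C where "u x < ereal C" using less_PInf_Ex_of_nat
    by (metis ereal_dense2)
  then show ?thesis using that x by (meson less_imp_le order_trans)
qed

text \<open>
  In the straightened coordinates \<open>(z, y) \<mapsto> (z, g z + y)\<close> the graph is \<open>K \<times> {0}\<close>, and the part of
  \<open>K \<times> cball 0 1\<close> where the inequality fails is compact and misses it, hence stays at positive
  distance from it.
\<close>

lemma usc_on_graph_tube: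
  fixes g :: "complex \<Rightarrow> complex"
  assumes "usc_on (K \<times> UNIV) u" "compact K" "continuous_on K g" "continuous_on K k"
    and less: "\<And>z. z \<in> K \<Longrightarrow> u (z, g z) < ereal (k z)"
  obtains \<eta> where "0 < \<eta>" "\<And>z y. z \<in> K \<Longrightarrow> cmod y \<le> \<eta> \<Longrightarrow> u (z, g z + y) < ereal (k z)"
proof -
  define T where "T = K \<times> cball (0::complex) 1"
  define v where "v = (\<lambda>x. u (fst x, g (fst x) + snd x))"
  have usc: "usc_on T v"
    unfolding v_def
  proof (rule usc_on_compose[OF assms(1)])
    show "continuous_on T (\<lambda>x. (fst x, g (fst x) + snd x))"
      unfolding T_def
      by (intro continuous_intros continuous_on_compose2[OF assms(3)]) auto
  qed (auto simp: T_def)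
  have contk: "continuous_on T (\<lambda>x. k (fst x))"
    unfolding T_def by (intro continuous_intros continuous_on_compose2[OF assms(4)]) auto
  have "compact T" unfolding T_def using assms(2) by (simp add: compact_Times)
  define B where "B = T - {x\<in>T. v x < ereal (k (fst x))}"
  have "openin (top_of_set T) {x\<in>T. v x < ereal (k (fst x))}"
    by (rule usc_on_less_continuous_openin[OF usc contk])
  then have "closedin (top_of_set T) B" unfolding B_def by (simp add: closedin_diff)
  then have "compact B" using \<open>compact T\<close> closedin_compact by blast
  show ?thesis
  proof (cases "B = {}")
    case True
    then have "\<And>z y. z \<in> K \<Longrightarrow> cmod y \<le> 1 \<Longrightarrow> u (z, g z + y) < ereal (k z)"
      by (force simp: B_def T_def v_def)
    then show ?thesis using that[of 1] by simp
  next
    case False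
    have "continuous_on B (\<lambda>x. cmod (snd x))" by (intro continuous_intros)
    then obtain b where b: "b \<in> B" "\<forall>x\<in>B. cmod (snd b) \<le> cmod (snd x)"
      using continuous_attains_inf[OF \<open>compact B\<close> False] by blast
    have "snd b \<noteq> 0"
    proof
      assume "snd b = 0"
      then show False using b(1) less[of "fst b"] by (auto simp: B_def T_def v_def)
    qed
    then have pos: "0 < min 1 (cmod (snd b) / 2)" by simp
    show ?thesis
    proof (rule that[OF pos])
      fix z y assume "z \<in> K" "cmod y \<le> min 1 (cmod (snd b) / 2)"
      then have "(z, y) \<in> T" "\<not> cmod (snd b) \<le> cmod y"
        using pos unfolding T_def min_less_iff_conj by (simp, linarith)
      then have "(z, y) \<notin> B" using b(2) by force
      with \<open>(z, y) \<in> T\<close> show "u (z, g z + y) < ereal (k z)" by (auto simp: B_def v_def)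
    qed
  qed
qed

section \<open>Circle means\<close>

text \<open>
  \<^const>\<open>ereal_integral\<close> is a difference of two nonnegative integrals. These are monotone for
  arbitrary integrands, so the pointwise bound passes to the means, and only the continuous majorant
  is integrated in the usual sense.
\<close>

lemma circle_mean_le_integral:
  assumes le: "\<And>t. t \<in> {0..2*pi} \<Longrightarrow> u (a + of_real r * cis t) \<le> ereal (\<psi> t)"
    and cont: "continuous_on {0..2*pi} \<psi>"
  shows "circle_mean u a r \<le> ereal (1 / (2*pi) * integral {0..2*pi} \<psi>)"
proof -
  define M where "M = restrict_space lborel {0..2*pi::real}"
  have sp: "space M = {0..2*pi}" by (simp add: M_def space_restrict_space)
  have int: "set_integrable lborel {0..2*pi} \<psi>"
    by (rule borel_integrable_atLeastAtMost'[OF cont])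
  then have int': "integrable M \<psi>"
    by (simp add: M_def integrable_restrict_space set_integrable_def)
  have "integral\<^sup>L M \<psi> = (LINT x:{0..2*pi}|lborel. \<psi> x)"
    by (simp add: M_def integral_restrict_space set_lebesgue_integral_def)
  also have "\<dots> = integral {0..2*pi} \<psi>"
    by (rule set_borel_integral_eq_integral[OF int])
  finally have eq: "integral\<^sup>L M \<psi> = integral {0..2*pi} \<psi>" .
  have 1: "(\<integral>\<^sup>+ x. e2ennreal (u (a + of_real r * cis x)) \<partial>M) \<le> (\<integral>\<^sup>+ x. ennreal (\<psi> x) \<partial>M)"
  proof (rule nn_integral_mono)
    fix t assume "t \<in> space M"
    then show "e2ennreal (u (a + of_real r * cis t)) \<le> ennreal (\<psi> t)"
      unfolding ennreal.abs_eq[symmetric] using le[of t] sp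
      by (metis e2ennreal_ereal e2ennreal_mono)
  qed
  have 2: "(\<integral>\<^sup>+ x. ennreal (- \<psi> x) \<partial>M) \<le> (\<integral>\<^sup>+ x. e2ennreal (- u (a + of_real r * cis x)) \<partial>M)"
  proof (rule nn_integral_mono)
    fix t assume "t \<in> space M"
    then have "ereal (- \<psi> t) \<le> - u (a + of_real r * cis t)"
      using le[of t] sp by (simp add: ereal_uminus_le_reorder flip: uminus_ereal.simps)
    then show "ennreal (- \<psi> t) \<le> e2ennreal (- u (a + of_real r * cis t))"
      by (metis e2ennreal_ereal e2ennreal_mono)
  qed
  have "ereal_integral M (\<lambda>t. u (a + of_real r * cis t))
      \<le> enn2ereal (\<integral>\<^sup>+ x. ennreal (\<psi> x) \<partial>M) - enn2ereal (\<integral>\<^sup>+ x. ennreal (- \<psi> x) \<partial>M)"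
    unfolding ereal_integral_def
    using 1 2 by (intro ereal_minus_mono) (simp_all add: less_eq_ennreal.rep_eq)
  also have "\<dots> = ereal (integral\<^sup>L M \<psi>)"
  proof -
    have f1: "(\<integral>\<^sup>+ x. ennreal (\<psi> x) \<partial>M) \<noteq> \<infinity>" and f2: "(\<integral>\<^sup>+ x. ennreal (- \<psi> x) \<partial>M) \<noteq> \<infinity>"
      using int' by (auto simp: real_integrable_def)
    have "enn2ereal x = ereal (enn2real x)" if "x \<noteq> \<infinity>" for x
      using that by (cases x) (auto simp: enn2ereal_ennreal)
    then show ?thesis
      using f1 f2 real_lebesgue_integral_def[OF int'] by simp
  qed
  finally have "ereal_integral M (\<lambda>t. u (a + of_real r * cis t)) \<le> ereal (integral {0..2*pi} \<psi>)"
    using eq by simp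
  then have "ereal (1 / (2*pi)) * ereal_integral M (\<lambda>t. u (a + of_real r * cis t))
      \<le> ereal (1 / (2*pi)) * ereal (integral {0..2*pi} \<psi>)"
    by (intro ereal_mult_left_mono) auto
  then show ?thesis by (simp add: circle_mean_def M_def)
qed

lemma holomorphic_mean_value_Re:
  assumes "G holomorphic_on ball 0 e" "0 < r" "r < e"
  shows "((\<lambda>t. Re (G (of_real r * cis t))) has_integral 2 * pi * Re (G 0)) {0..2*pi}"
proof -
  have "((\<lambda>u. G u / (u - 0)) has_contour_integral 2 * of_real pi * \<i> * G 0) (circlepath 0 r)"
  proof (rule Cauchy_integral_circlepath)
    show "continuous_on (cball 0 r) G"
      using assms by (intro holomorphic_on_imp_continuous_on holomorphic_on_subset[OF assms(1)]) auto
    show "G holomorphic_on ball 0 r"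
      using assms by (intro holomorphic_on_subset[OF assms(1)]) auto
  qed (use assms in auto)
  then have "((\<lambda>t. G (0 + of_real r * cis t) / (0 + of_real r * cis t - 0) * of_real r * \<i> * cis t)
      has_integral 2 * of_real pi * \<i> * G 0) {0..2*pi}"
    unfolding circlepath_def by (subst (asm) has_contour_integral_part_circlepath_iff) auto
  then have "((\<lambda>t. \<i> * G (of_real r * cis t)) has_integral 2 * of_real pi * \<i> * G 0) {0..2*pi}"
    by (rule has_integral_eq[rotated]) (use assms in \<open>auto simp: field_simps\<close>)
  from has_integral_linear[OF this bounded_linear_Im]
  show ?thesis by (simp add: o_def mult.assoc)
qed

section \<open>A maximum principle along holomorphic graphs\<close>

text \<open>
  The analytic heart of the maximum principle below. Plurisubharmonicity only speaks about complex
  lines, while the function to be controlled lives on the curve \<open>w = g z\<close>; the complex line used here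
  is the translate of the tangent line of the curve through the touching point \<open>(z0, g z0 + y0)\<close>.
  Along it \<open>w - g z\<close> is holomorphic with vanishing derivative, so the penalty \<open>N * \<bar>w - g z\<bar>^2\<close> is the
  real part of a holomorphic function up to an error \<open>o(r^2)\<close>, however large \<open>N\<close> is. The term
  \<open>- \<epsilon> * \<bar>z\<bar>^2\<close> has circle mean lower than its value at the centre by \<open>\<epsilon> * r^2\<close>, which wins and
  contradicts the sub-mean value inequality.
\<close>

lemma psh_not_touched_along_tangent:
  assumes psh: "plurisubharmonic_on (D \<times> UNIV) u"
    and e: "0 < e" "ball z0 e \<subseteq> D"
    and g: "g holomorphic_on ball z0 e" and G: "G holomorphic_on ball z0 e"
    and \<epsilon>: "0 < \<epsilon>" and N: "0 \<le> N" and y0: "cmod y0 < \<eta>"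
    and m: "u (z0, g z0 + y0) = ereal m"
    and touch: "\<And>z y. z \<in> ball z0 e \<Longrightarrow> cmod y < \<eta> \<Longrightarrow>
      u (z, g z + y) \<le> ereal (m + Re (G z) - Re (G z0)
        - \<epsilon> * ((cmod z)\<^sup>2 - (cmod z0)\<^sup>2) + N * ((cmod y)\<^sup>2 - (cmod y0)\<^sup>2))"
  shows False
proof -
  define g' where "g' = deriv g z0"
  define K where "K = (\<lambda>s. g (z0 + s) - g z0 - s * g')"
  have shift: "(\<lambda>s. F (z0 + s)) holomorphic_on ball 0 e" if "F holomorphic_on ball z0 e" for F
  proof -
    have "(F \<circ> (\<lambda>s. z0 + s)) holomorphic_on ball 0 e"
      by (rule holomorphic_on_compose_gen[OF _ that]) (auto intro!: holomorphic_intros simp: dist_norm)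
    then show ?thesis by (simp add: o_def)
  qed
  have K: "K holomorphic_on ball 0 e"
    unfolding K_def by (intro holomorphic_intros shift g)
  have K0: "K 0 = 0" by (simp add: K_def)
  (* The error K is o(r); this rate makes N * cmod (K s)^2 at most half of \<epsilon> * r^2. *)
  define \<kappa> where "\<kappa> = sqrt (\<epsilon> / (2 * (N + 1)))"
  have \<kappa>: "0 < \<kappa>" using \<epsilon> N by (simp add: \<kappa>_def)
  have \<kappa>2: "N * \<kappa>\<^sup>2 \<le> \<epsilon> / 2"
  proof -
    have "N * \<kappa>\<^sup>2 \<le> (N + 1) * \<kappa>\<^sup>2" by (intro mult_right_mono) auto
    also have "\<dots> = \<epsilon> / 2" using \<epsilon> N by (simp add: \<kappa>_def field_simps)
    finally show ?thesis .
  qed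
  have "(g has_field_derivative g') (at z0)"
    unfolding g'_def using g e by (intro holomorphic_derivI[of g "ball z0 e"]) auto
  then have "((\<lambda>h. (g (z0 + h) - g z0) / h - g') \<longlongrightarrow> 0) (at 0)"
    by (simp add: DERIV_def LIM_zero_iff)
  then have "\<forall>\<^sub>F h in at 0. dist ((g (z0 + h) - g z0) / h - g') 0 < \<kappa>"
    using \<kappa> tendstoD by blast
  then obtain d where d: "d > 0" "\<And>h. h \<noteq> 0 \<Longrightarrow> cmod h < d \<Longrightarrow> cmod ((g (z0 + h) - g z0) / h - g') < \<kappa>"
    unfolding eventually_at by (auto simp: dist_norm)
  have K_le: "cmod (K h) \<le> \<kappa> * cmod h" if "cmod h < d" for h
  proof (cases "h = 0")
    case False
    then have "K h = ((g (z0 + h) - g z0) / h - g') * h"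
      by (simp add: K_def field_simps)
    then have "cmod (K h) = cmod ((g (z0 + h) - g z0) / h - g') * cmod h"
      by (simp add: norm_mult)
    also have "\<dots> \<le> \<kappa> * cmod h"
      using d(2)[OF False that] by (intro mult_right_mono) auto
    finally show ?thesis .
  qed (simp add: K0)
  define r where "r = min (min (e / 2) (d / 2)) ((\<eta> - cmod y0) / (2 * \<kappa>))"
  have r: "0 < r" "r < e" "r < d" "\<kappa> * r < \<eta> - cmod y0"
  proof -
    show "0 < r" "r < e" "r < d" using e d \<kappa> y0 by (auto simp: r_def min_less_iff_disj)
    have "\<kappa> * r \<le> \<kappa> * ((\<eta> - cmod y0) / (2 * \<kappa>))"
      using \<kappa> by (intro mult_left_mono) (auto simp: r_def)
    also have "\<dots> < \<eta> - cmod y0" using \<kappa> y0 by (simp add: field_simps)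
    finally show "\<kappa> * r < \<eta> - cmod y0" .
  qed
  (* The real part of H collects every pluriharmonic contribution of the majorant along the line. *)
  define H where "H = (\<lambda>s. G (z0 + s) - G z0 - of_real (2 * \<epsilon>) * (cnj z0 * s)
                          - of_real (2 * N) * (cnj y0 * K s))"
  have H: "H holomorphic_on ball 0 e"
    unfolding H_def by (intro holomorphic_intros shift G K)
  have H0: "H 0 = 0" by (simp add: H_def K0)
  define a where "a = (z0, g z0 + y0)"
  define b where "b = (1::complex, g')"
  define v where "v = (\<lambda>l. u (complex_line a b l))"
  have "subharmonic_on {l. complex_line a b l \<in> D \<times> UNIV} v"
    using psh unfolding plurisubharmonic_on_def v_def by blast
  moreover have "cball 0 r \<subseteq> {l. complex_line a b l \<in> D \<times> UNIV}"
  proof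
    fix l :: complex assume "l \<in> cball 0 r"
    then have "z0 + l \<in> ball z0 e" using r by (simp add: dist_norm)
    then show "l \<in> {l. complex_line a b l \<in> D \<times> UNIV}"
      using e by (auto simp: complex_line_def a_def b_def)
  qed
  ultimately have "v 0 \<le> circle_mean v 0 r"
    using r unfolding subharmonic_on_def by blast
  also have "\<dots> \<le> ereal (1 / (2*pi) *
      integral {0..2*pi} (\<lambda>t. m - \<epsilon> * r\<^sup>2 / 2 + Re (H (of_real r * cis t))))"
  proof (rule circle_mean_le_integral)
    fix t :: real
    define l where "l = of_real r * cis t"
    have l: "cmod l = r" using r by (simp add: l_def norm_mult)
    have Kl: "cmod (K l) \<le> \<kappa> * r" using K_le[of l] l r by simp
    have sq: "(cmod (y0 - K l))\<^sup>2 - (cmod y0)\<^sup>2 = (cmod (K l))\<^sup>2 - 2 * Re (cnj y0 * K l)"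
      unfolding cmod_power2 by (simp add: power2_eq_square algebra_simps)
    have sqz: "(cmod (z0 + l))\<^sup>2 - (cmod z0)\<^sup>2 = r\<^sup>2 + 2 * Re (cnj z0 * l)"
      unfolding l[symmetric] cmod_power2 by (simp add: power2_eq_square algebra_simps)
    have "complex_line a b l = (z0 + l, g (z0 + l) + (y0 - K l))"
      by (simp add: complex_line_def a_def b_def K_def)
    moreover have "z0 + l \<in> ball z0 e" using l r by (simp add: dist_norm)
    moreover have "cmod (y0 - K l) < \<eta>"
      using norm_triangle_ineq4[of y0 "K l"] Kl r by linarith
    ultimately have "v l \<le> ereal (m + Re (G (z0 + l)) - Re (G z0)
        - \<epsilon> * ((cmod (z0 + l))\<^sup>2 - (cmod z0)\<^sup>2) + N * ((cmod (y0 - K l))\<^sup>2 - (cmod y0)\<^sup>2))"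
      unfolding v_def using touch by simp
    also have "\<dots> = ereal (m - \<epsilon> * r\<^sup>2 + N * (cmod (K l))\<^sup>2 + Re (H l))"
      unfolding sq sqz H_def by (simp add: algebra_simps)
    also have "\<dots> \<le> ereal (m - \<epsilon> * r\<^sup>2 / 2 + Re (H l))"
    proof -
      have "N * (cmod (K l))\<^sup>2 \<le> N * (\<kappa> * r)\<^sup>2"
        using Kl N by (intro mult_left_mono power_mono) auto
      also have "\<dots> = (N * \<kappa>\<^sup>2) * r\<^sup>2" by (simp add: power_mult_distrib)
      also have "\<dots> \<le> \<epsilon> / 2 * r\<^sup>2" using \<kappa>2 by (intro mult_right_mono) auto
      finally show ?thesis by simp
    qed
    finally show "v (0 + of_real r * cis t) \<le> ereal (m - \<epsilon> * r\<^sup>2 / 2 + Re (H (of_real r * cis t)))"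
      by (simp add: l_def)
  next
    have "continuous_on (ball 0 e) H" using H by (rule holomorphic_on_imp_continuous_on)
    then have "continuous_on {0..2*pi} (\<lambda>t. H (of_real r * cis t))"
      by (rule continuous_on_compose2) (use r in \<open>auto simp: norm_mult intro!: continuous_intros\<close>)
    then show "continuous_on {0..2*pi} (\<lambda>t. m - \<epsilon> * r\<^sup>2 / 2 + Re (H (of_real r * cis t)))"
      by (intro continuous_intros)
  qed
  also have "integral {0..2*pi} (\<lambda>t. m - \<epsilon> * r\<^sup>2 / 2 + Re (H (of_real r * cis t)))
      = 2 * pi * (m - \<epsilon> * r\<^sup>2 / 2)"
  proof (rule integral_unique)
    show "((\<lambda>t. m - \<epsilon> * r\<^sup>2 / 2 + Re (H (of_real r * cis t))) has_integral
        2 * pi * (m - \<epsilon> * r\<^sup>2 / 2)) {0..2*pi}"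
      using has_integral_add[OF has_integral_const_real[of "m - \<epsilon> * r\<^sup>2 / 2" 0 "2*pi"]
          holomorphic_mean_value_Re[OF H r(1,2)]] H0 by simp
  qed
  finally have "v 0 \<le> ereal (m - \<epsilon> * r\<^sup>2 / 2)" by simp
  moreover have "v 0 = ereal m" using m by (simp add: v_def complex_line_def a_def b_def)
  moreover have "0 < \<epsilon> * r\<^sup>2" using \<epsilon> r by simp
  ultimately show False by simp
qed

text \<open>
  Harmonicity, in the form in which the mean value property is immediate and which the functions
  \<open>ln (cmod (z - a))\<close> satisfy by branches of the logarithm.
\<close>

definition locally_Re_holomorphic_on :: "complex set \<Rightarrow> (complex \<Rightarrow> real) \<Rightarrow> bool" where
  "locally_Re_holomorphic_on U h \<longleftrightarrow>
     (\<forall>z\<in>U. \<exists>e>0. \<exists>G. G holomorphic_on ball z e \<and> (\<forall>x\<in>ball z e. h x = Re (G x)))"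

lemma locally_Re_holomorphic_on_const: "locally_Re_holomorphic_on U (\<lambda>_. c)"
  unfolding locally_Re_holomorphic_on_def
  by (intro ballI exI[of _ 1] exI[of _ "\<lambda>_. of_real c"] conjI) auto

lemma locally_Re_holomorphic_on_linear_combination:
  assumes "locally_Re_holomorphic_on U h1" "locally_Re_holomorphic_on U h2"
  shows "locally_Re_holomorphic_on U (\<lambda>z. a * h1 z + b * h2 z)"
  unfolding locally_Re_holomorphic_on_def
proof
  fix z assume "z \<in> U"
  then obtain e1 G1 e2 G2 where
    1: "e1 > 0" "G1 holomorphic_on ball z e1" "\<forall>x\<in>ball z e1. h1 x = Re (G1 x)" and
    2: "e2 > 0" "G2 holomorphic_on ball z e2" "\<forall>x\<in>ball z e2. h2 x = Re (G2 x)"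
    using assms unfolding locally_Re_holomorphic_on_def by meson
  show "\<exists>e>0. \<exists>G. G holomorphic_on ball z e \<and> (\<forall>x\<in>ball z e. a * h1 x + b * h2 x = Re (G x))"
  proof (intro exI[of _ "min e1 e2"] exI[of _ "\<lambda>z. of_real a * G1 z + of_real b * G2 z"] conjI ballI)
    show "(\<lambda>z. of_real a * G1 z + of_real b * G2 z) holomorphic_on ball z (min e1 e2)"
      by (intro holomorphic_intros holomorphic_on_subset[OF 1(2)] holomorphic_on_subset[OF 2(2)]) auto
  qed (use 1 2 in auto)
qed

lemma locally_Re_holomorphic_on_sum:
  assumes "finite I" "\<And>i. i \<in> I \<Longrightarrow> locally_Re_holomorphic_on U (h i)"
  shows "locally_Re_holomorphic_on U (\<lambda>z. \<Sum>i\<in>I. h i z)"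
  using assms
proof (induction I rule: finite_induct)
  case empty
  then show ?case by (simp add: locally_Re_holomorphic_on_const)
next
  case (insert i I)
  then show ?case
    using locally_Re_holomorphic_on_linear_combination[of U "h i" "\<lambda>z. \<Sum>i\<in>I. h i z" 1 1] by simp
qed

text \<open>
  Near \<open>z\<close> the quotient \<open>(x - a) / (z - a)\<close> stays in the right half plane, where \<^const>\<open>Ln\<close> is
  holomorphic.
\<close>

lemma locally_Re_holomorphic_on_ln_cmod:
  assumes "a \<notin> U"
  shows "locally_Re_holomorphic_on U (\<lambda>z. ln (cmod (z - a)))"
  unfolding locally_Re_holomorphic_on_def
proof
  fix z assume "z \<in> U"
  then have za: "z - a \<noteq> 0" using assms by auto
  have near: "Re ((x - a) / (z - a)) > 0" if "x \<in> ball z (cmod (z - a))" for x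
  proof -
    have "(x - a) / (z - a) = 1 - (z - x) / (z - a)" using za by (simp add: field_simps)
    moreover have "cmod ((z - x) / (z - a)) < 1" using that za by (simp add: norm_divide dist_norm)
    ultimately show ?thesis using complex_Re_le_cmod[of "(z - x) / (z - a)"] by simp
  qed
  show "\<exists>e>0. \<exists>G. G holomorphic_on ball z e \<and> (\<forall>x\<in>ball z e. ln (cmod (x - a)) = Re (G x))"
  proof (intro exI[of _ "cmod (z - a)"] conjI
      exI[of _ "\<lambda>x. of_real (ln (cmod (z - a))) + Ln ((x - a) / (z - a))"] ballI)
    show "(\<lambda>x. of_real (ln (cmod (z - a))) + Ln ((x - a) / (z - a))) holomorphic_on ball z (cmod (z - a))"
      using near za by (intro holomorphic_intros) (auto simp: complex_nonpos_Reals_iff dest: less_imp_le leD)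
    fix x assume "x \<in> ball z (cmod (z - a))"
    then have "(x - a) / (z - a) \<noteq> 0" using near by fastforce
    then have "Re (Ln ((x - a) / (z - a))) = ln (cmod (x - a)) - ln (cmod (z - a))"
      using za by (simp add: norm_divide ln_div)
    then show "ln (cmod (x - a)) = Re (of_real (ln (cmod (z - a))) + Ln ((x - a) / (z - a)))"
      by simp
  qed (use za in simp)
qed

text \<open>
  The maximum principle for a plurisubharmonic function on a holomorphic graph over a compact set.
  Instead of proving that \<open>z \<mapsto> u (z, g z)\<close> is subharmonic, one maximises
  \<open>u (z, g z + y) - h z + \<epsilon> * \<bar>z\<bar>^2 - N * \<bar>y\<bar>^2\<close> over a tube \<open>cmod y \<le> \<eta>\<close> around the graph. If the
  claim failed, then for thin tubes the maximum would not lie over the frontier of \<open>X\<close>, for large \<open>N\<close>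
  it would not lie on the side of the tube, and an interior maximum is excluded by
  \<open>psh_not_touched_along_tangent\<close>.
\<close>

lemma psh_on_graph_le_harmonic_majorant:
  assumes psh: "plurisubharmonic_on (D \<times> UNIV) u"
    and X: "compact X" "X \<subseteq> D"
    and g: "continuous_on X g" "g holomorphic_on interior X"
    and h: "continuous_on X h" "locally_Re_holomorphic_on (interior X) h"
    and bd: "\<And>z. z \<in> frontier X \<Longrightarrow> u (z, g z) \<le> ereal (h z)"
    and "z1 \<in> X"
  shows "u (z1, g z1) \<le> ereal (h z1)"
proof (rule ccontr)
  assume "\<not> ?thesis"
  then obtain c1 where c1: "ereal (h z1) < ereal c1" "ereal c1 < u (z1, g z1)"
    using ereal_dense2 by (meson not_le)
  define c where "c = c1 - h z1"
  have c: "c > 0" "ereal (h z1 + c) < u (z1, g z1)" using c1 by (simp_all add: c_def)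
  have uscD: "usc_on (D \<times> UNIV) u" using psh by (simp add: plurisubharmonic_on_def)
  obtain R where R: "\<And>z. z \<in> X \<Longrightarrow> cmod z \<le> R" "R > 0"
    using compact_imp_bounded[OF X(1)] bounded_pos by blast
  define \<epsilon> where "\<epsilon> = c / (2 * R\<^sup>2)"
  have \<epsilon>: "\<epsilon> > 0" and \<epsilon>R: "\<epsilon> * R\<^sup>2 = c / 2" using c R by (simp_all add: \<epsilon>_def)
  have \<epsilon>z: "\<epsilon> * (cmod z)\<^sup>2 \<le> c / 2" if "z \<in> X" for z
    unfolding \<epsilon>R[symmetric] using \<epsilon> R that by (intro mult_left_mono power_mono) auto
  define k where "k = (\<lambda>z. h z - \<epsilon> * (cmod z)\<^sup>2 + c)"
  have contk: "continuous_on X k" unfolding k_def by (intro continuous_intros h)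
  have fX: "frontier X \<subseteq> X" using X(1) compact_imp_closed frontier_subset_closed by blast
  have "\<exists>\<eta>>0. \<forall>z\<in>frontier X. \<forall>y. cmod y \<le> \<eta> \<longrightarrow> u (z, g z + y) < ereal (k z)"
  proof (rule usc_on_graph_tube)
    show "usc_on (frontier X \<times> UNIV) u" using fX X by (intro usc_on_subset[OF uscD]) auto
    show "compact (frontier X)" using X(1) by (rule compact_frontier)
    show "continuous_on (frontier X) g" "continuous_on (frontier X) k"
      using fX g contk continuous_on_subset by blast+
    fix z assume z: "z \<in> frontier X"
    then have "h z < k z" using \<epsilon>z[of z] fX c by (auto simp: k_def)
    then show "u (z, g z) < ereal (k z)" using bd[OF z] by (simp add: le_less_trans)
  qed blast
  then obtain \<eta> where \<eta>: "0 < \<eta>"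
      "\<And>z y. z \<in> frontier X \<Longrightarrow> cmod y \<le> \<eta> \<Longrightarrow> u (z, g z + y) < ereal (k z)"
    by blast
  define T where "T = X \<times> cball (0::complex) \<eta>"
  define v where "v = (\<lambda>x. u (fst x, g (fst x) + snd x))"
  have contT: "continuous_on T (\<lambda>x. F (fst x))" if "continuous_on X F" for F :: "complex \<Rightarrow> 'z::topological_space"
    unfolding T_def by (intro continuous_intros continuous_on_compose2[OF that]) auto
  have "compact T" unfolding T_def using X by (simp add: compact_Times)
  have uscv: "usc_on T v"
    unfolding v_def
  proof (rule usc_on_compose[OF uscD])
    show "continuous_on T (\<lambda>x. (fst x, g (fst x) + snd x))"
      by (intro continuous_intros contT g)
  qed (use X in \<open>auto simp: T_def\<close>)
  (* This bound involves the tube only, so N may still be chosen depending on C. *)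
  obtain C where C: "\<And>x. x \<in> T \<Longrightarrow> v x - ereal (k (fst x)) \<le> ereal C"
    using usc_on_compact_bounded[OF usc_on_minus_continuous[OF uscv contT[OF contk]] \<open>compact T\<close>]
    by blast
  define N where "N = (\<bar>C\<bar> + 1) / \<eta>\<^sup>2"
  have N: "N \<ge> 0" "N * \<eta>\<^sup>2 > C" using \<eta> by (auto simp: N_def)
  define w where "w = (\<lambda>x. v x - ereal (k (fst x) + N * (cmod (snd x))\<^sup>2))"
  have uscw: "usc_on T w"
    unfolding w_def by (intro usc_on_minus_continuous uscv continuous_intros contT contk)
  have z1T: "(z1, 0) \<in> T" using \<open>z1 \<in> X\<close> \<eta> by (simp add: T_def)
  then obtain x where x: "x \<in> T" "\<forall>y\<in>T. w y \<le> w x"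
    using usc_on_compact_attains_sup[OF uscw \<open>compact T\<close>] by blast
  obtain z0 y0 where zy: "x = (z0, y0)" by (cases x)
  have z0: "z0 \<in> X" "cmod y0 \<le> \<eta>" using x zy by (auto simp: T_def)
  have "k z1 \<le> h z1 + c" using \<epsilon> by (simp add: k_def)
  then have "ereal (k z1) < v (z1, 0)" using c(2) 
    by (metis (mono_tags) v_def add.right_neutral ereal_less_eq(3) fst_conv le_less_trans snd_conv)
  then have "w (z1, 0) > 0"
    unfolding w_def by (cases "v (z1, 0)") auto
  then have wpos: "w x > 0" using x z1T by (meson less_le_trans)
  have "v x \<noteq> -\<infinity>" using wpos unfolding w_def by auto
  moreover have "v x < \<infinity>" using uscv x(1) by (auto simp: usc_on_def)
  ultimately obtain m where m: "v x = ereal m" by (cases "v x") auto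
  have mk: "m > k z0 + N * (cmod y0)\<^sup>2" using wpos m by (simp add: w_def zy)
  have y0: "cmod y0 < \<eta>"
  proof (rule ccontr)
    assume "\<not> ?thesis"
    then have "cmod y0 = \<eta>" using z0 by simp
    moreover have "m - k z0 \<le> C" using C[OF x(1)] m by (simp add: zy)
    ultimately show False using mk N by simp
  qed
  have "z0 \<notin> frontier X"
  proof
    assume "z0 \<in> frontier X"
    then have "m < k z0" using \<eta>(2)[of z0 y0] z0 m by (simp add: v_def zy)
    then show False using mk N by (smt (verit) mult_nonneg_nonneg zero_le_power2)
  qed
  then have int: "z0 \<in> interior X" using z0 by (simp add: frontier_def closure_def)
  obtain e1 G where e1: "e1 > 0" "G holomorphic_on ball z0 e1" "\<And>x. x \<in> ball z0 e1 \<Longrightarrow> h x = Re (G x)"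
    using h(2) int unfolding locally_Re_holomorphic_on_def by meson
  obtain e2 where e2: "e2 > 0" "ball z0 e2 \<subseteq> interior X"
    using int open_interior open_contains_ball by blast
  define e where "e = min e1 e2"
  have e: "e > 0" "ball z0 e \<subseteq> ball z0 e1" "ball z0 e \<subseteq> interior X"
    using e1 e2 by (auto simp: e_def)
  have eX: "ball z0 e \<subseteq> X" using e(3) interior_subset by blast
  show False
  proof (rule psh_not_touched_along_tangent[OF psh e(1)])
    show "ball z0 e \<subseteq> D" using eX X by blast
    show "g holomorphic_on ball z0 e" "G holomorphic_on ball z0 e"
      using e g e1 holomorphic_on_subset by blast+
    show "u (z0, g z0 + y0) = ereal m" using m by (simp add: v_def zy)
    fix z y assume z: "z \<in> ball z0 e" and y: "cmod y < \<eta>"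
    have "(z, y) \<in> T" using eX z y by (auto simp: T_def)
    then have "w (z, y) \<le> w x" using x by blast
    then have "u (z, g z + y) - ereal (k z + N * (cmod y)\<^sup>2) \<le> ereal (m - (k z0 + N * (cmod y0)\<^sup>2))"
      unfolding w_def m by (simp add: v_def zy)
    then have "u (z, g z + y) \<le> ereal (m + k z - k z0 + N * (cmod y)\<^sup>2 - N * (cmod y0)\<^sup>2)"
      by (cases "u (z, g z + y)") auto
    moreover have "h z = Re (G z)" "h z0 = Re (G z0)" using e1 e z by auto
    ultimately show "u (z, g z + y) \<le> ereal (m + Re (G z) - Re (G z0)
        - \<epsilon> * ((cmod z)\<^sup>2 - (cmod z0)\<^sup>2) + N * ((cmod y)\<^sup>2 - (cmod y0)\<^sup>2))"
      by (simp add: k_def algebra_simps)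
  qed (use \<epsilon> N y0 in auto)
qed

section \<open>Series of simple poles\<close>

definition pole_series :: "(nat \<Rightarrow> real) \<Rightarrow> (nat \<Rightarrow> complex) \<Rightarrow> complex \<Rightarrow> complex" where
  "pole_series c a z = (\<Sum>k. of_real (c k) / (z - a k))"

lemma pole_series_uniform_limit:
  assumes "summable c" "\<And>k. 0 \<le> c k" "0 < d" "\<And>z k. z \<in> S \<Longrightarrow> d \<le> cmod (z - a k)"
  shows "uniform_limit S (\<lambda>n z. \<Sum>k<n. of_real (c k) / (z - a k)) (pole_series c a) sequentially"
  unfolding pole_series_def
proof (rule Weierstrass_m_test)
  show "summable (\<lambda>k. c k / d)" using assms(1) by (rule summable_divide)
  fix k z assume "z \<in> S"
  then have "d \<le> cmod (z - a k)" by (rule assms(4))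
  then have "c k / cmod (z - a k) \<le> c k / d"
    using assms(2,3) by (intro divide_left_mono mult_pos_pos) auto
  then show "norm (of_real (c k) / (z - a k)) \<le> c k / d"
    using assms(2)[of k] by (simp add: norm_divide)
qed

lemma pole_series_holomorphic_on:
  assumes "summable c" "\<And>k. 0 \<le> c k" "open S" "\<And>k. a k \<notin> S"
  shows "pole_series c a holomorphic_on S"
proof (rule holomorphic_uniform_sequence[OF \<open>open S\<close>])
  show "(\<lambda>z. \<Sum>k<n. of_real (c k) / (z - a k)) holomorphic_on S" for n
    using assms(4) by (intro holomorphic_intros) auto
  fix z assume "z \<in> S"
  then obtain e where e: "e > 0" "ball z e \<subseteq> S" using \<open>open S\<close> open_contains_ball by blast
  show "\<exists>d. 0 < d \<and> cball z d \<subseteq> S \<and>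
      uniform_limit (cball z d) (\<lambda>n z. \<Sum>k<n. of_real (c k) / (z - a k)) (pole_series c a) sequentially"
  proof (intro exI[of _ "e / 2"] conjI)
    show "cball z (e / 2) \<subseteq> S" using e by (intro subset_trans[OF _ e(2)]) auto
    show "uniform_limit (cball z (e / 2)) (\<lambda>n z. \<Sum>k<n. of_real (c k) / (z - a k)) (pole_series c a) sequentially"
    proof (rule pole_series_uniform_limit)
      fix x k assume "x \<in> cball z (e / 2)"
      moreover have "e \<le> dist z (a k)" using e(2) assms(4)[of k] by (auto simp: not_less subset_iff)
      ultimately show "e / 2 \<le> cmod (x - a k)"
        using dist_triangle[of z "a k" x] by (simp add: dist_norm)
    qed (use assms e in auto)
  qed (use e in simp)
qed

section \<open>Propagation of the value minus infinity\<close>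

text \<open>
  Weights for the barrier \<open>ln (r / \<bar>z - q\<bar>) - (\<Sum>k. \<delta> k * ln (T k / \<bar>z - a k\<bar>))\<close>, where
  \<open>T k = r + dist (a k) q\<close> is an upper bound for \<open>\<bar>z - a k\<bar>\<close> on \<open>cball q r\<close>, so every subtracted
  term is nonnegative there. First \<open>\<delta> k\<close> is chosen so small that at \<open>p\<close> the subtracted terms cost at
  most half of the main term; then \<open>\<rho> k\<close> so small that on the circle of radius \<open>\<rho> k\<close> around \<open>a k\<close> the
  \<open>k\<close>-th term alone cancels the maximum \<open>ln (r / s)\<close> of the main term; finally the residue \<open>c k\<close> so
  small that outside these discs the pole series is bounded independently of the poles.
\<close>

lemma exists_small_pole_weights:
  fixes a :: "nat \<Rightarrow> complex"
  assumes "0 < s" "s < dist p q" "dist p q < r" "\<And>k. a k \<noteq> p"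
  obtains c \<delta> \<rho> :: "nat \<Rightarrow> real" where
    "\<And>k. 0 < c k" "\<And>k. c k \<le> (1/2)^k" "\<And>k. c k \<le> \<rho> k * (1/2)^k" "\<And>k. 0 < \<rho> k" "\<And>k. 0 < \<delta> k"
    "\<And>k. \<delta> k * ln ((r + dist (a k) q) / dist p (a k)) \<le> ln (r / dist p q) * (1/2)^(k+2)"
    "\<And>k. \<delta> k * ln ((r + dist (a k) q) / \<rho> k) = ln (r / s)"
proof -
  define \<omega> where "\<omega> = ln (r / dist p q)"
  define T where "T = (\<lambda>k. r + dist (a k) q)"
  define l where "l = (\<lambda>k. ln (T k / dist p (a k)))"
  define \<delta> where "\<delta> = (\<lambda>k. \<omega> * (1/2)^(k+2) / (1 + l k))"
  define \<rho> where "\<rho> = (\<lambda>k. T k * exp (- ln (r / s) / \<delta> k))"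
  define c where "c = (\<lambda>k. min 1 (\<rho> k) * (1/2)^k)"
  have r: "r > 0" using assms by (meson less_trans)
  have \<omega>: "\<omega> > 0" unfolding \<omega>_def using less_trans[OF assms(1,2)] assms(3) by (intro ln_gt_zero) (simp add: less_divide_eq_1_pos)
  have T: "T k > 0" for k using r by (simp add: T_def add_pos_nonneg)
  have l: "l k \<ge> 0" for k
  proof -
    have "dist p (a k) \<le> T k"
      using assms(3) dist_triangle[of p "a k" q] by (simp add: T_def dist_commute)
    moreover have "0 < dist p (a k)" using assms(4)[of k] by auto
    ultimately show ?thesis unfolding l_def by (intro ln_ge_zero) (simp add: le_divide_eq_1_pos)
  qed
  have \<delta>: "\<delta> k > 0" for k unfolding \<delta>_def using \<omega> l[of k] by (intro divide_pos_pos) auto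
  have \<rho>: "\<rho> k > 0" for k using T by (simp add: \<rho>_def)
  show ?thesis
  proof (rule that[of c \<rho> \<delta>])
    fix k
    show "0 < c k" using \<rho> by (simp add: c_def)
    show "c k \<le> (1/2)^k" "c k \<le> \<rho> k * (1/2)^k"
      unfolding c_def by (auto intro!: mult_left_le_one_le mult_right_mono simp: \<rho> less_imp_le)
    have "\<delta> k * l k \<le> \<delta> k * (1 + l k)" using \<delta>[of k] by (intro mult_left_mono) auto
    also have "\<dots> = \<omega> * (1/2)^(k+2)"
      unfolding \<delta>_def using l[of k] by (intro nonzero_divide_eq_eq[THEN iffD1, OF _ refl, symmetric]) auto
    finally show "\<delta> k * ln ((r + dist (a k) q) / dist p (a k)) \<le> ln (r / dist p q) * (1/2)^(k+2)"
      by (simp add: l_def T_def \<omega>_def)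
    have "T k / \<rho> k = exp (ln (r / s) / \<delta> k)"
      using T[of k] by (simp add: \<rho>_def exp_minus field_simps)
    then have "\<delta> k * ln (T k / \<rho> k) = ln (r / s)" using \<delta>[of k] by simp
    then show "\<delta> k * ln ((r + dist (a k) q) / \<rho> k) = ln (r / s)" by (simp add: T_def)
  qed (use \<rho> \<delta> in auto)
qed

text \<open>
  The value -\<infinity> spreads from the graph over a small circle around \<open>q\<close> to the point over \<open>p\<close>, even
  if poles of the series accumulate at \<open>p\<close>. Replace \<open>f\<close> by the rational function \<open>g\<close> that is a
  partial sum plus the constant making \<open>g p = f p\<close>; upper semicontinuity alone would relate the
  values of \<open>u\<close> at \<open>(p, g p)\<close> and \<open>(p, f p)\<close> in the wrong direction, hence this exact adjustment.
  For many terms \<open>g\<close> is close to \<open>f\<close> on the circle, so \<open>u < - M\<close> there on the graph of \<open>g\<close>. Off the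
  discs of radius \<open>\<rho> k\<close> the function \<open>g\<close> is bounded by 6, so \<open>u \<le> C\<close> with \<open>C\<close> independent of \<open>M\<close>
  and of the number of terms. The barrier then gives \<open>u (p, f p) \<le> C - M * (\<omega> / (2 * L))\<close>, a two-constants
  estimate whose factor \<open>\<omega> / (2 * L)\<close> depends only on \<open>p\<close>, \<open>q\<close>, \<open>r\<close> and \<open>s\<close>, and \<open>M\<close> is arbitrary.
\<close>

lemma psh_minus_infinity_propagates:
  fixes a :: "nat \<Rightarrow> complex" and c \<delta> \<rho> :: "nat \<Rightarrow> real"
  assumes psh: "plurisubharmonic_on (D \<times> UNIV) u" and D: "cball q r \<subseteq> D"
    and s: "0 < s" "s < dist p q" "dist p q < r"
    and c: "\<And>k. 0 < c k" "\<And>k. c k \<le> (1/2)^k" "\<And>k. c k \<le> \<rho> k * (1/2)^k"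
    and \<rho>: "\<And>k. 0 < \<rho> k" and \<delta>: "\<And>k. 0 < \<delta> k"
    and \<delta>p: "\<And>k. \<delta> k * ln ((r + dist (a k) q) / dist p (a k)) \<le> ln (r / dist p q) * (1/2)^(k+2)"
    and \<delta>\<rho>: "\<And>k. \<delta> k * ln ((r + dist (a k) q) / \<rho> k) = ln (r / s)"
    and a: "\<And>k. a k \<noteq> p" "\<And>k. 2 * s \<le> dist q (a k)"
    and minf: "\<And>z. z \<in> sphere q s \<Longrightarrow> u (z, pole_series c a z) = -\<infinity>"
  shows "u (p, pole_series c a p) = -\<infinity>"
proof -
  define f where "f = pole_series c a"
  define S where "S = (\<lambda>n z. \<Sum>k<n. of_real (c k) / (z - a k))"
  define T where "T = (\<lambda>k. r + dist (a k) q)"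
  define \<omega> where "\<omega> = ln (r / dist p q)"
  define L where "L = ln (r / s)"
  have r: "r > 0" using s by linarith
  have \<omega>: "0 < \<omega>" unfolding \<omega>_def using less_trans[OF s(1,2)] s(3) by (intro ln_gt_zero) (simp add: less_divide_eq_1_pos)
  have \<omega>L: "\<omega> < L" unfolding \<omega>_def L_def
    using s r less_trans[OF s(1,2)] by (subst ln_less_cancel_iff) (simp_all add: divide_strict_left_mono)
  have T: "T k > 0" for k using r by (simp add: T_def add_pos_nonneg)
  have le_T: "cmod (z - a k) \<le> T k" if "z \<in> cball q r" for z k
    using that dist_triangle[of z "a k" q] by (simp add: T_def dist_commute flip: dist_norm)
  have ln_T: "ln (T k / x) = ln (T k) - ln x" if "x > 0" for k x
    using T[of k] that by (simp add: ln_div)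
  have \<delta>p': "\<delta> k * (ln (T k) - ln (cmod (p - a k))) \<le> \<omega> * (1/2)^(k+2)" for k
    using \<delta>p[of k] ln_T[of "cmod (p - a k)" k] a(1)[of k] by (simp add: T_def \<omega>_def dist_norm)
  have \<delta>\<rho>': "\<delta> k * (ln (T k) - ln (\<rho> k)) = L" for k
    using \<delta>\<rho>[of k] ln_T[OF \<rho>[of k], of k] by (simp add: T_def L_def)
  (* The k-th barrier term costs less at p than it yields at distance \<rho> k, so p lies off the k-th disc. *)
  have p_far: "\<rho> k < cmod (p - a k)" for k
  proof -
    have "\<omega> * (1/2)^(k+2) \<le> \<omega> * 1" using \<omega> by (intro mult_left_mono power_le_one) auto
    then have "\<delta> k * (ln (T k) - ln (cmod (p - a k))) < \<delta> k * (ln (T k) - ln (\<rho> k))"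
      using \<delta>p'[of k] \<delta>\<rho>'[of k] \<omega>L by linarith
    then have "ln (\<rho> k) < ln (cmod (p - a k))" using \<delta>[of k] by (simp add: mult_less_cancel_left_pos)
    then show ?thesis using \<rho>[of k] a(1)[of k] by simp
  qed
  have term_le: "cmod (of_real (c k) / (z - a k)) \<le> (1/2)^k" if "\<rho> k \<le> cmod (z - a k)" for k z
  proof -
    have "c k \<le> cmod (z - a k) * (1/2)^k"
      by (rule order_trans[OF c(3) mult_right_mono[OF that]]) simp
    moreover have "cmod (z - a k) > 0" using that \<rho>[of k] by linarith
    ultimately show ?thesis
      using less_imp_le[OF c(1)[of k]] by (simp add: norm_divide pos_divide_le_eq mult.commute)
  qed
  have geo: "(\<Sum>k<n. (1/2::real)^k) \<le> 2" for n
    using sum_le_suminf[of "\<lambda>k. (1/2::real)^k" "{..<n}"] by (simp add: suminf_geometric summable_geometric)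
  have S_le: "cmod (S n z) \<le> 2" if "\<And>k. k < n \<Longrightarrow> \<rho> k \<le> cmod (z - a k)" for n z
    unfolding S_def by (rule order_trans[OF sum_norm_le geo]) (use term_le that in auto)
  have S_p: "(\<lambda>n. S n p) \<longlonglongrightarrow> f p"
  proof -
    have "summable (\<lambda>k. of_real (c k) / (p - a k))"
      by (rule summable_comparison_test'[of "\<lambda>k. (1/2)^k" 0])
         (auto simp: summable_geometric term_le less_imp_le[OF p_far])
    then show ?thesis unfolding S_def f_def pole_series_def by (rule summable_LIMSEQ)
  qed
  have f_p: "cmod (f p) \<le> 2"
    using p_far less_imp_le by (intro tendsto_le[OF _ tendsto_const tendsto_norm[OF S_p]] always_eventually)
      (auto intro!: S_le)
  have "summable c"
    by (rule summable_comparison_test'[of "\<lambda>k. (1/2)^k" 0])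
       (use c in \<open>auto simp: summable_geometric less_imp_le abs_of_pos\<close>)
  have S_sphere: "uniform_limit (sphere q s) S f sequentially"
    unfolding S_def f_def
  proof (rule pole_series_uniform_limit[OF \<open>summable c\<close>])
    fix z k assume "z \<in> sphere q s"
    then show "s \<le> cmod (z - a k)"
      using a(2)[of k] dist_triangle[of q "a k" z] by (simp add: dist_norm)
  qed (use c s in \<open>auto simp: less_imp_le\<close>)
  have S_cont: "continuous_on (sphere q s) (S n)" for n
    unfolding S_def using a(2) s
    by (intro continuous_intros) (smt (verit) dist_commute dist_eq_0_iff mem_sphere right_minus_eq)
  have f_cont: "continuous_on (sphere q s) f"
    by (rule uniform_limit_theorem[OF _ S_sphere]) (auto simp: S_cont)
  have uscD: "usc_on (D \<times> UNIV) u" using psh by (simp add: plurisubharmonic_on_def)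
  obtain C' where C': "\<And>x. x \<in> cball q r \<times> cball 0 6 \<Longrightarrow> u x \<le> ereal C'"
  proof (rule usc_on_compact_bounded)
    show "usc_on (cball q r \<times> cball 0 6) u" using D by (intro usc_on_subset[OF uscD]) auto
  qed (auto simp: compact_Times)
  define C where "C = max C' 0"
  have C: "C \<ge> 0" "\<And>z w. z \<in> cball q r \<Longrightarrow> cmod w \<le> 6 \<Longrightarrow> u (z, w) \<le> ereal C"
  proof -
    show "C \<ge> 0" by (simp add: C_def)
    fix z w assume "z \<in> cball q r" "cmod w \<le> 6"
    then have "u (z, w) \<le> ereal C'" by (intro C') auto
    also have "\<dots> \<le> ereal C" by (simp add: C_def)
    finally show "u (z, w) \<le> ereal C" .
  qed
  have bound: "u (p, f p) \<le> ereal (C - M * (\<omega> / (2 * L)))" if M: "M \<ge> 0" for M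
  proof -
    have ssD: "sphere q s \<subseteq> D"
    proof
      fix z assume "z \<in> sphere q s"
      then have "z \<in> cball q r" using s by simp
      then show "z \<in> D" using D by blast
    qed
    have "\<exists>\<eta>>0. \<forall>z\<in>sphere q s. \<forall>y. cmod y \<le> \<eta> \<longrightarrow> u (z, f z + y) < ereal (- M)"
    proof (rule usc_on_graph_tube)
      show "usc_on (sphere q s \<times> UNIV) u"
        using ssD by (intro usc_on_subset[OF uscD]) auto
      show "u (z, f z) < ereal (- M)" if "z \<in> sphere q s" for z
        using minf[OF that] by (simp add: f_def)
    qed (use f_cont in \<open>auto simp: continuous_on_const\<close>)
    then obtain \<eta> where \<eta>: "\<eta> > 0"
        "\<And>z y. z \<in> sphere q s \<Longrightarrow> cmod y \<le> \<eta> \<Longrightarrow> u (z, f z + y) < ereal (- M)" by blast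
    have "\<forall>\<^sub>F n in sequentially. \<forall>z\<in>sphere q s. dist (S n z) (f z) < \<eta> / 2"
      using S_sphere \<eta>(1) by (intro uniform_limitD) auto
    moreover have "\<forall>\<^sub>F n in sequentially. dist (S n p) (f p) < \<eta> / 2"
      using S_p \<eta>(1) by (intro tendstoD) auto
    ultimately have "\<forall>\<^sub>F n in sequentially. (\<forall>z\<in>sphere q s. dist (S n z) (f z) < \<eta> / 2)
        \<and> dist (S n p) (f p) < \<eta> / 2" by (rule eventually_conj)
    then obtain n where n: "\<And>z. z \<in> sphere q s \<Longrightarrow> dist (S n z) (f z) < \<eta> / 2" "dist (S n p) (f p) < \<eta> / 2"
      unfolding eventually_sequentially by blast
    define g where "g = (\<lambda>z. S n z + (f p - S n p))"
    (* Only the finitely many discs around poles of g are removed, and X avoids q and these poles. *)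
    define X where "X = cball q r - ball q s - (\<Union>k<n. ball (a k) (\<rho> k))"
    define A where "A = (M + C) / L"
    (* C minus A times the barrier, arranged as a nested linear combination of ln (cmod (z - a)). *)
    define h where "h = (\<lambda>z. 1 * (1 * (C - A * ln r) + A * ln (cmod (z - q)))
        + A * (\<Sum>k<n. \<delta> k * ln (T k) + (- \<delta> k) * ln (cmod (z - a k))))"
    have h_eq: "h z = C - A * ((ln r - ln (cmod (z - q))) - (\<Sum>k<n. \<delta> k * (ln (T k) - ln (cmod (z - a k)))))" for z
      unfolding h_def by (simp add: algebra_simps)
    have A: "A \<ge> 0" "A * L = M + C" using M C \<omega> \<omega>L by (auto simp: A_def)
    have X: "compact X" "X \<subseteq> cball q r"
      unfolding X_def by (auto intro!: compact_diff)
    have Xa: "\<rho> k \<le> cmod (z - a k)" "z \<noteq> a k" if "z \<in> X" "k < n" for z k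
    proof -
      show "\<rho> k \<le> cmod (z - a k)" using that by (auto simp: X_def dist_norm norm_minus_commute not_less)
      then show "z \<noteq> a k" using \<rho>[of k] by auto
    qed
    have Xq: "s \<le> cmod (z - q)" "z \<noteq> q" if "z \<in> X" for z
      using that s by (auto simp: X_def dist_norm norm_minus_commute not_less)
    have terms: "0 \<le> \<delta> k * (ln (T k) - ln (cmod (z - a k)))" if "z \<in> X" "k < n" for z k
    proof -
      have "cmod (z - a k) \<le> T k" using le_T X that by blast
      then show ?thesis
        using \<delta>[of k] Xa[OF that] T[of k] by (intro mult_nonneg_nonneg) simp_all
    qed
    have "u (p, g p) \<le> ereal (h p)"
    proof (rule psh_on_graph_le_harmonic_majorant[OF psh X(1)])
      show "X \<subseteq> D" using X D by blast
      have "g holomorphic_on (- {a k | k. k < n})"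
        unfolding g_def S_def by (intro holomorphic_intros) auto
      moreover have "X \<subseteq> - {a k | k. k < n}" using Xa by blast
      ultimately have gX: "g holomorphic_on X" by (rule holomorphic_on_subset)
      then show "continuous_on X g" by (rule holomorphic_on_imp_continuous_on)
      show "g holomorphic_on interior X" using gX interior_subset by (rule holomorphic_on_subset)
      show "continuous_on X h"
        unfolding h_def using Xa Xq by (intro continuous_intros) auto
      have "a k \<notin> interior X" if "k < n" for k using Xa that interior_subset by blast
      moreover have "q \<notin> interior X" using Xq interior_subset by blast
      ultimately show "locally_Re_holomorphic_on (interior X) h"
        unfolding h_def
        by (intro locally_Re_holomorphic_on_linear_combination locally_Re_holomorphic_on_const
            locally_Re_holomorphic_on_sum locally_Re_holomorphic_on_ln_cmod) auto
      show "p \<in> X"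
        using s p_far by (auto simp: X_def dist_commute[of q] dist_commute[of "a _"] not_less less_imp_le
            simp flip: dist_norm)
      fix z assume z: "z \<in> frontier X"
      then have zX: "z \<in> X" using X(1) compact_imp_closed frontier_subset_closed by blast
      have "cmod (g z) \<le> cmod (S n z) + (cmod (f p) + cmod (S n p))"
        unfolding g_def by (rule order_trans[OF norm_triangle_ineq add_left_mono[OF norm_triangle_ineq4]])
      also have "\<dots> \<le> 6"
        using S_le[of n z] S_le[of n p] f_p Xa zX p_far less_imp_le by fastforce
      finally have uC: "u (z, g z) \<le> ereal C" using C(2) zX X(2) by blast
      have lnq: "ln (cmod (z - q)) \<ge> ln s" using Xq[OF zX] s by simp
      have L_eq: "L = ln r - ln s" using r s by (simp add: L_def ln_div)
      have cases: "cmod (z - q) = r \<or> cmod (z - q) = s \<or> (\<exists>k<n. cmod (z - a k) = \<rho> k)"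
      proof (rule ccontr)
        assume "\<not> ?thesis"
        then have "z \<in> ball q r - cball q s - (\<Union>k<n. cball (a k) (\<rho> k))" (is "z \<in> ?O")
          using zX by (auto simp: X_def dist_norm norm_minus_commute le_less)
        moreover have "open ?O" by (intro open_Diff open_ball closed_cball closed_UN) auto
        moreover have "?O \<subseteq> X" unfolding X_def by auto
        ultimately have "z \<in> interior X" by (meson interiorI)
        then show False using z by (simp add: frontier_def)
      qed
      have sum_nonneg: "0 \<le> (\<Sum>k<n. \<delta> k * (ln (T k) - ln (cmod (z - a k))))"
        using terms zX by (intro sum_nonneg) auto
      have "h z \<ge> C \<or> (cmod (z - q) = s \<and> h z \<ge> - M)"
        using cases
      proof (elim disjE exE conjE)
        assume "cmod (z - q) = r"
        then have "h z \<ge> C" unfolding h_eq using sum_nonneg A by (simp add: mult_nonneg_nonneg)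
        then show ?thesis ..
      next
        fix k assume k: "k < n" "cmod (z - a k) = \<rho> k"
        have "\<delta> k * (ln (T k) - ln (cmod (z - a k))) \<le> (\<Sum>k<n. \<delta> k * (ln (T k) - ln (cmod (z - a k))))"
          using terms zX k by (intro member_le_sum) auto
        then have "A * ((ln r - ln (cmod (z - q))) - (\<Sum>k<n. \<delta> k * (ln (T k) - ln (cmod (z - a k))))) \<le> 0"
          using lnq L_eq \<delta>\<rho>'[of k] k A by (intro mult_nonneg_nonpos) auto
        then have "h z \<ge> C" unfolding h_eq by simp
        then show ?thesis ..
      next
        assume zs: "cmod (z - q) = s"
        have "A * ((ln r - ln (cmod (z - q))) - (\<Sum>k<n. \<delta> k * (ln (T k) - ln (cmod (z - a k))))) \<le> A * L"
          unfolding L_eq zs using sum_nonneg A by (intro mult_left_mono) auto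
        then have "h z \<ge> - M" unfolding h_eq A(2) by simp
        then show ?thesis using zs by blast
      qed
      then show "u (z, g z) \<le> ereal (h z)"
      proof
        assume "h z \<ge> C"
        then show ?thesis using uC by (meson ereal_less_eq(3) order_trans)
      next
        assume *: "cmod (z - q) = s \<and> h z \<ge> - M"
        then have zs: "z \<in> sphere q s" by (simp add: dist_norm norm_minus_commute)
        have "cmod (g z - f z) \<le> \<eta>"
        proof -
          have "g z - f z = (S n z - f z) - (S n p - f p)" by (simp add: g_def)
          then have "cmod (g z - f z) \<le> cmod (S n z - f z) + cmod (S n p - f p)"
            by (metis norm_triangle_ineq4)
          then show ?thesis using n(1)[OF zs] n(2) by (simp add: dist_norm)
        qed
        then have "u (z, g z) < ereal (- M)" using \<eta>(2)[OF zs, of "g z - f z"] by simp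
        then show ?thesis using * by (meson ereal_less_eq(3) less_imp_le order_trans)
      qed
    qed
    also have "h p \<le> C - M * (\<omega> / (2 * L))"
    proof -
      have "(\<Sum>k<n. \<delta> k * (ln (T k) - ln (cmod (p - a k)))) \<le> (\<Sum>k<n. \<omega> / 4 * (1/2)^k)"
        using \<delta>p' by (intro sum_mono) (simp add: power_add field_simps)
      also have "\<dots> = \<omega> / 4 * (\<Sum>k<n. (1/2)^k)" by (simp add: sum_distrib_left)
      also have "\<dots> \<le> \<omega> / 4 * 2" using \<omega> geo by (intro mult_left_mono) auto
      finally have "\<omega> / 2 \<le> \<omega> - (\<Sum>k<n. \<delta> k * (ln (T k) - ln (cmod (p - a k))))" by simp
      moreover have "\<omega> = ln r - ln (cmod (p - q))" using less_trans[OF s(1,2)] r by (simp add: \<omega>_def dist_norm ln_div)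
      ultimately have "A * (\<omega> / 2)
          \<le> A * ((ln r - ln (cmod (p - q))) - (\<Sum>k<n. \<delta> k * (ln (T k) - ln (cmod (p - a k)))))"
        using A(1) by (intro mult_left_mono) auto
      then have "A * (\<omega> / 2) \<le> C - h p" unfolding h_eq by simp
      moreover have "M / L * (\<omega> / 2) \<le> A * (\<omega> / 2)"
        unfolding A_def using C M \<omega> \<omega>L by (intro mult_right_mono divide_right_mono) auto
      ultimately show ?thesis by simp
    qed
    finally show ?thesis by (simp add: g_def)
  qed
  show ?thesis
  proof (rule ccontr)
    assume "u (p, pole_series c a p) \<noteq> -\<infinity>"
    then have "u (p, f p) \<noteq> -\<infinity>" by (simp add: f_def)
    moreover have "u (p, f p) \<le> ereal C" using bound[of 0] by simp
    ultimately obtain b where b: "u (p, f p) = ereal b" by (cases "u (p, f p)") auto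
    define M where "M = (C - b + 1) / (\<omega> / (2 * L))"
    have "b \<le> C" using \<open>u (p, f p) \<le> ereal C\<close> b by simp
    then have "M \<ge> 0" "M * (\<omega> / (2 * L)) = C - b + 1" using \<omega> \<omega>L by (auto simp: M_def)
    then show False using bound[of M] b by simp
  qed
qed

section \<open>Accessible frontier points\<close>

text \<open>
  Otherwise the frontier of \<open>D1\<close> would be sparse in \<open>D2\<close>, and removing it would leave a connected set
  covered by \<open>D1\<close> and the exterior of \<open>D1\<close>. The exterior would then miss \<open>D2\<close>, so \<open>D2 - D1\<close> would
  consist of frontier points only, and a density point of it would be a limit point of the frontier after all.
\<close>

lemma frontier_limit_point_exists:
  assumes D1: "is_domain D1" and D2: "is_domain D2" and sub: "D1 \<subseteq> D2"
    and p0: "p0 \<in> D2" "density_point p0 (D2 - D1)"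
  obtains p where "p \<in> D2" "p islimpt frontier D1"
proof (rule ccontr)
  assume "\<not> thesis"
  then have "\<forall>x\<in>D2. \<not> x islimpt frontier D1" using that by blast
  then have "frontier D1 sparse_in D2"
    using D2 by (simp add: sparse_in_open is_domain_def)
  then have conn: "connected (D2 - frontier D1)"
    using D2 by (intro sparse_imp_connected) (auto simp: is_domain_def)
  have "open D1" "D1 \<noteq> {}" using D1 by (auto simp: is_domain_def)
  then have fr: "frontier D1 = closure D1 - D1" by (simp add: frontier_def interior_open)
  have "D2 - D1 \<subseteq> frontier D1"
  proof (rule ccontr)
    assume "\<not> ?thesis"
    then have "(- closure D1) \<inter> (D2 - frontier D1) \<noteq> {}" unfolding fr by blast
    moreover have "D1 \<inter> (D2 - frontier D1) \<noteq> {}" using \<open>D1 \<noteq> {}\<close> sub fr by blast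
    moreover have "D2 - frontier D1 \<subseteq> D1 \<union> - closure D1" unfolding fr by blast
    moreover have "D1 \<inter> - closure D1 = {}" using closure_subset by blast
    ultimately show False
      using connectedD[OF conn \<open>open D1\<close>, of "- closure D1"] by auto
  qed
  moreover have "p0 islimpt (D2 - D1)"
    using p0(2) unfolding density_point_def islimpt_eq_acc_point by (simp add: Int_commute)
  ultimately have "p0 islimpt frontier D1" using islimpt_subset by blast
  then show False using \<open>\<forall>x\<in>D2. \<not> x islimpt frontier D1\<close> p0(1) by blast
qed

text \<open>
  The poles are taken among the frontier points nearest to the points of a countable dense set. Mere
  density in the frontier would not do: a pole can only be felt by a Taylor series if it is
  accessible, and a nearest point can be approached along a straight segment on which no other
  frontier point is closer. The point \<open>p\<close> must not be a pole since the series has to converge there,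
  so only those points count that are nearer to the frontier than to \<open>p\<close>.
\<close>

lemma dense_nearest_frontier_points:
  fixes D :: "complex set"
  assumes "open D" and p: "p islimpt frontier D"
  obtains a :: "nat \<Rightarrow> complex" where
    "\<And>n. a n \<in> frontier D" "\<And>n. a n \<noteq> p"
    "\<And>N x. open N \<Longrightarrow> x \<in> N \<inter> D \<Longrightarrow> infdist x (frontier D) < dist x p
      \<Longrightarrow> \<exists>y\<in>N \<inter> D. \<exists>n. dist y (a n) = infdist y (frontier D)"
proof -
  obtain Z :: "complex set" where Z: "countable Z" "\<And>X. open X \<Longrightarrow> X \<noteq> {} \<Longrightarrow> \<exists>d\<in>Z. d \<in> X"
    using countable_dense_exists by metis
  define W where "W = D \<inter> {x. infdist x (frontier D) < dist x p}"
  have "open W" unfolding W_def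
    by (intro open_Int \<open>open D\<close> open_Collect_less continuous_intros)
  obtain a0 where a0: "a0 \<in> frontier D" "a0 \<noteq> p"
    using p open_UNIV unfolding islimpt_def by blast
  have "\<forall>x. \<exists>b. b \<in> frontier D \<and> infdist x (frontier D) = dist x b"
    using infdist_attains_inf[OF frontier_closed, of D] a0(1) by blast
  from choice[OF this] obtain b where b: "\<And>x. b x \<in> frontier D" "\<And>x. infdist x (frontier D) = dist x (b x)"
    by blast
  (* The extra point a0 only ensures that the set of poles is nonempty and can be enumerated. *)
  define P where "P = insert a0 (b ` (Z \<inter> W))"
  have P: "countable P" "P \<noteq> {}" using Z by (auto simp: P_def)
  define a where "a = from_nat_into P"
  have range: "range a = P" unfolding a_def by (rule range_from_nat_into[OF P(2,1)])
  have P_sub: "x \<in> frontier D \<and> x \<noteq> p" if "x \<in> P" for x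
    using that a0 b by (auto simp: P_def W_def)
  show ?thesis
  proof (rule that)
    fix n
    have "a n \<in> P" using range by blast
    then show "a n \<in> frontier D" "a n \<noteq> p" using P_sub by auto
  next
    fix N x assume N: "open N" "x \<in> N \<inter> D" "infdist x (frontier D) < dist x p"
    then have "open (N \<inter> W)" "N \<inter> W \<noteq> {}" using \<open>open W\<close> by (auto simp: W_def)
    then obtain y where y: "y \<in> Z" "y \<in> N \<inter> W" using Z(2) by blast
    then have "b y \<in> range a" unfolding range P_def by blast
    then obtain n where "a n = b y" by auto
    then show "\<exists>y\<in>N \<inter> D. \<exists>n. dist y (a n) = infdist y (frontier D)"
      using y b(2)[of y] by (intro bexI[of _ y] exI[of _ n]) (auto simp: W_def)
  qed
qed

section \<open>The domain of existence of a pole series\<close>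

text \<open>
  On the segment from \<open>x\<close> to its nearest pole \<open>a j\<close> the moving point is at least as far from every
  other pole as from \<open>a j\<close>, so the terms of \<open>(w - a j) * f w\<close> are dominated by \<open>c k\<close>. By Tannery's
  theorem it tends to the sum of all \<open>c k\<close> with \<open>a k = a j\<close>. Positivity of the residues prevents
  repeated poles from cancelling in this sum, whereas a continuous extension would force the limit 0.
\<close>

lemma pole_series_no_continuous_extension:
  fixes c :: "nat \<Rightarrow> real"
  assumes c: "summable c" "\<And>k. 0 < c k"
    and near: "\<And>k. dist x (a j) \<le> dist x (a k)" and x: "x \<noteq> a j"
    and eq: "\<And>t. 0 < t \<Longrightarrow> t \<le> 1 \<Longrightarrow> pole_series c a (a j + of_real t * (x - a j)) = \<Phi> (a j + of_real t * (x - a j))"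
    and cont: "isCont \<Phi> (a j)"
  shows False
proof -
  define t where "t = (\<lambda>n. inverse (real (Suc n)))"
  define w where "w = (\<lambda>n. a j + of_real (t n) * (x - a j))"
  have t: "0 < t n" "t n \<le> 1" for n by (auto simp: t_def inverse_le_1_iff)
  have "t \<longlonglongrightarrow> 0" unfolding t_def by (rule LIMSEQ_inverse_real_of_nat)
  then have "w \<longlonglongrightarrow> a j + of_real 0 * (x - a j)" unfolding w_def by (intro tendsto_intros)
  then have w: "w \<longlonglongrightarrow> a j" by simp
  have wj: "cmod (w n - a j) = t n * dist x (a j)" for n
    using t[of n] by (simp add: w_def norm_mult dist_norm)
  have far: "cmod (w n - a j) \<le> cmod (w n - a k)" for n k
  proof -
    have "x - w n = of_real (1 - t n) * (x - a j)" by (simp add: w_def algebra_simps)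
    then have "dist x (w n) = (1 - t n) * dist x (a j)"
      using t[of n] by (simp add: dist_norm norm_mult del: of_real_diff)
    then have "dist x (a k) \<le> (1 - t n) * dist x (a j) + dist (w n) (a k)"
      using dist_triangle[of x "a k" "w n"] by simp
    then show ?thesis using near[of k] wj[of n] by (simp add: dist_norm algebra_simps)
  qed
  have w_ne: "w n \<noteq> a j" for n using wj[of n] t[of n] x by auto
  define T where "T = (\<lambda>k n. (w n - a j) * (of_real (c k) / (w n - a k)))"
  define B where "B = (\<lambda>k. if a k = a j then of_real (c k) else 0 :: complex)"
  have T_le: "cmod (T k n) \<le> c k" for k n
  proof -
    have "cmod (T k n) = c k * (cmod (w n - a j) / cmod (w n - a k))"
      using c(2)[of k] by (simp add: T_def norm_mult norm_divide)
    also have "\<dots> \<le> c k * 1"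
      using c(2)[of k] far[of n k] by (intro mult_left_mono) (auto simp: divide_le_eq_1)
    finally show ?thesis by simp
  qed
  have T_lim: "T k \<longlonglongrightarrow> B k" for k
  proof (cases "a k = a j")
    case True
    then have "T k = (\<lambda>n. B k)" using w_ne by (auto simp: T_def B_def)
    then show ?thesis by simp
  next
    case False
    then have "T k \<longlonglongrightarrow> (a j - a j) * (of_real (c k) / (a j - a k))"
      unfolding T_def by (intro tendsto_intros w) auto
    then show ?thesis using False by (simp add: B_def)
  qed
  have "(\<forall>\<^sub>F n in sequentially. summable (\<lambda>k. norm (T k n))) \<and> summable (\<lambda>n. norm (B n))
      \<and> (\<lambda>n. \<Sum>k. T k n) \<longlonglongrightarrow> suminf B"
    by (rule tannerys_theorem[OF T_lim _ c(1)]) (simp_all add: case_prod_unfold T_le)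
  then have B: "summable B" and lim: "(\<lambda>n. \<Sum>k. T k n) \<longlonglongrightarrow> suminf B"
    using summable_norm_cancel by auto
  have "(\<Sum>k. T k n) = (w n - a j) * \<Phi> (w n)" for n
  proof -
    have "summable (\<lambda>k. T k n)"
      by (rule summable_comparison_test'[OF c(1)]) (rule T_le)
    then have "summable (\<lambda>k. of_real (c k) / (w n - a k))"
      unfolding T_def by (rule summable_mult_D) (use w_ne[of n] in simp)
    then have "(\<Sum>k. T k n) = (w n - a j) * pole_series c a (w n)"
      unfolding T_def pole_series_def by (rule suminf_mult)
    then show ?thesis using eq[OF t] by (simp add: w_def)
  qed
  moreover have "(\<lambda>n. (w n - a j) * \<Phi> (w n)) \<longlonglongrightarrow> (a j - a j) * \<Phi> (a j)"
    by (intro tendsto_intros w isCont_tendsto_compose[OF cont])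
  ultimately have "suminf B = 0" using lim LIMSEQ_unique by fastforce
  have "summable (\<lambda>k. Re (B k))" using B by (rule summable_Re)
  then have "Re (B j) \<le> (\<Sum>k. Re (B k))"
    using sum_le_suminf[of "\<lambda>k. Re (B k)" "{j}"] c(2) by (auto simp: B_def less_imp_le)
  also have "\<dots> = Re (suminf B)" using B by (simp add: bounded_linear.suminf[OF bounded_linear_Re])
  finally show False using \<open>suminf B = 0\<close> c(2)[of j] by (simp add: B_def)
qed

lemma ball_infdist_frontier_subset:
  fixes D :: "'a::euclidean_space set"
  assumes "x \<in> D"
  shows "ball x (infdist x (frontier D)) \<subseteq> D"
proof (rule ccontr)
  assume "\<not> ?thesis"
  then have "ball x (infdist x (frontier D)) - D \<noteq> {}" by blast
  moreover then have "x \<in> ball x (infdist x (frontier D))"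
    by (metis Diff_empty ball_eq_empty centre_in_ball empty_Diff not_le)
  ultimately obtain w where "w \<in> ball x (infdist x (frontier D))" "w \<in> frontier D"
    using connected_Int_frontier[OF connected_ball, of x _ D] assms by blast
  then show False using infdist_le[of w "frontier D" x] by simp
qed

text \<open>
  If the Taylor series at \<open>z0\<close> converged beyond the nearest frontier point, its sum \<open>\<Phi>\<close> would agree
  with the pole series on the component \<open>V\<close> of \<open>D \<inter> ball z0 R\<close> containing \<open>z0\<close>, and it suffices to
  find in \<open>V\<close> a point whose nearest frontier point is a pole in \<open>ball z0 R\<close>. Density provides one near
  any point of \<open>V\<close> that is closer to the frontier than to \<open>p\<close> and whose distances to \<open>z0\<close> and to the
  frontier add up to less than \<open>R\<close>. The point \<open>z0\<close> itself qualifies unless \<open>p\<close> is nearest to \<open>z0\<close>;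
  in that case other frontier points accumulate at \<open>p\<close>, the boundary of \<open>V\<close> meets every punctured disc around \<open>p\<close>, and a point of
  \<open>V\<close> close to such a boundary point will do.
\<close>

lemma pole_series_domain_of_existence:
  fixes c :: "nat \<Rightarrow> real"
  assumes D: "is_domain D" and p: "p islimpt frontier D"
    and c: "summable c" "\<And>k. 0 < c k"
    and a: "\<And>n. a n \<in> frontier D" "\<And>n. a n \<noteq> p"
    and dense: "\<And>N x. open N \<Longrightarrow> x \<in> N \<inter> D \<Longrightarrow> infdist x (frontier D) < dist x p
      \<Longrightarrow> \<exists>y\<in>N \<inter> D. \<exists>n. dist y (a n) = infdist y (frontier D)"
  shows "domain_of_existence D (pole_series c a)"
  unfolding domain_of_existence_def
proof (intro conjI ballI D)
  define f where "f = pole_series c a"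
  define F where "F = frontier D"
  have "open D" using D by (simp add: is_domain_def)
  have FD: "F \<inter> D = {}" using \<open>open D\<close> by (auto simp: F_def frontier_def interior_open)
  have pF: "p \<in> F" using p closed_limpt[of F] frontier_closed by (auto simp: F_def)
  have aF: "a n \<in> F" for n using a by (simp add: F_def)
  show holf: "pole_series c a holomorphic_on D"
    using c a FD by (intro pole_series_holomorphic_on \<open>open D\<close>) (auto simp: F_def less_imp_le)
  fix z0 assume z0: "z0 \<in> D"
  define d where "d = infdist z0 F"
  obtain b where b: "b \<in> F" "d = dist z0 b"
    using infdist_attains_inf[of F z0] pF frontier_closed unfolding F_def d_def by blast
  have d: "d > 0" using b z0 FD by auto
  have "(INF w\<in>frontier D. ereal (dist z0 w)) = ereal d"
  proof (rule antisym)
    show "(INF w\<in>frontier D. ereal (dist z0 w)) \<le> ereal d"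
      unfolding b(2) using b(1) by (intro INF_lower) (simp add: F_def)
    show "ereal d \<le> (INF w\<in>frontier D. ereal (dist z0 w))"
      by (intro INF_greatest) (simp add: d_def F_def infdist_le)
  qed
  moreover have ballD: "ball z0 d \<subseteq> D"
    unfolding d_def F_def by (rule ball_infdist_frontier_subset[OF z0])
  then have hol: "f holomorphic_on eball z0 (ereal d)"
    using holf holomorphic_on_subset by (force simp: f_def)
  then have "ereal d \<le> fps_conv_radius (fps_expansion f z0)"
    by (rule conv_radius_fps_expansion)
  moreover have "\<not> ereal d < fps_conv_radius (fps_expansion f z0)"
  proof
    assume "ereal d < fps_conv_radius (fps_expansion f z0)"
    then obtain R where R: "d < R" "ereal R < fps_conv_radius (fps_expansion f z0)"
      using ereal_dense2 by force
    define \<Phi> where "\<Phi> = (\<lambda>w. eval_fps (fps_expansion f z0) (w - z0))"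
    have "eval_fps (fps_expansion f z0) holomorphic_on ball 0 R"
    proof (rule holomorphic_on_eval_fps, rule subsetI)
      fix x :: complex assume "x \<in> ball 0 R"
      then have "ereal (dist 0 x) < ereal R" by simp
      also note R(2)
      finally show "x \<in> eball 0 (fps_conv_radius (fps_expansion f z0))" by (simp add: in_eball_iff)
    qed
    then have "(eval_fps (fps_expansion f z0) \<circ> (\<lambda>w. w - z0)) holomorphic_on ball z0 R"
      by (intro holomorphic_on_compose_gen[where t = "ball 0 R"])
         (auto intro!: holomorphic_intros simp: dist_norm norm_minus_commute)
    then have \<Phi>: "\<Phi> holomorphic_on ball z0 R" by (simp add: \<Phi>_def o_def)
    have \<Phi>_eq: "\<Phi> w = f w" if "w \<in> ball z0 d" for w
      unfolding \<Phi>_def using eval_fps_expansion[OF hol] that by simp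
    define U where "U = D \<inter> ball z0 R"
    define V where "V = connected_component_set U z0"
    have "open U" using \<open>open D\<close> by (simp add: U_def open_Int)
    moreover have "z0 \<in> U" using z0 R d by (simp add: U_def)
    ultimately have V: "open V" "connected V" "V \<subseteq> U" "z0 \<in> V"
      unfolding V_def by (simp_all add: open_connected_component connected_component_subset)
    have absorb: "C \<subseteq> V" if C: "connected C" "C \<subseteq> U" and y: "y \<in> C" "y \<in> V" for C y
    proof -
      have "C \<subseteq> connected_component_set U y" using C y by (intro connected_component_maximal)
      also have "\<dots> = V" using y connected_component_eq unfolding V_def by blast
      finally show ?thesis .
    qed
    have ballV: "ball z0 d \<subseteq> V"
      using ballD R d V(4) by (intro absorb[of _ z0]) (auto simp: U_def)
    have eqV: "f w = \<Phi> w" if "w \<in> V" for w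
    proof (rule analytic_continuation_open[of "ball z0 d" V f \<Phi>])
      show "f holomorphic_on V" using holf V(3) holomorphic_on_subset unfolding f_def U_def by blast
      show "\<Phi> holomorphic_on V" using \<Phi> V(3) holomorphic_on_subset unfolding U_def by blast
    qed (use ballV V d that \<Phi>_eq in auto)
    have "\<exists>x\<in>V. infdist x F < dist x p \<and> dist z0 x + infdist x F < R"
    proof (cases "d < dist z0 p")
      case True
      then show ?thesis using V(4) R(1) by (intro bexI[of _ z0]) (auto simp: d_def)
    next
      case False
      then have dp: "dist z0 p = d" using infdist_le[OF pF, of z0] by (simp add: d_def)
      (* One \<epsilon> each for: dist p w, dist w x, and the distance from x to the frontier. *)
      define \<epsilon> where "\<epsilon> = (R - d) / 3"
      have \<epsilon>: "\<epsilon> > 0" "3 * \<epsilon> = R - d" using R by (auto simp: \<epsilon>_def)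
      define X where "X = ball p \<epsilon> - {p}"
      have "connected X" unfolding X_def by (rule connected_punctured_ball) simp
      have "p \<in> closure (ball z0 d)" using dp d by simp
      then obtain y where y: "y \<in> ball z0 d" "dist y p < \<epsilon>" using \<epsilon>(1) closure_approachable by blast
      then have "y \<in> X \<inter> V" using ballV dp by (auto simp: X_def dist_commute)
      moreover obtain y' where "y' \<in> F" "y' \<in> ball p \<epsilon>" "y' \<noteq> p"
        using p \<epsilon>(1) unfolding islimpt_def F_def by (metis centre_in_ball open_ball)
      then have "y' \<in> X - V" using FD V(3) by (auto simp: X_def U_def)
      ultimately obtain w where w: "w \<in> X" "w \<in> frontier V"
        using connected_Int_frontier[OF \<open>connected X\<close>, of V] by blast
      have "w \<in> ball z0 R"
        using w(1) dp \<epsilon> dist_triangle[of z0 w p] by (simp add: X_def)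
      have wV: "w \<in> closure V" "w \<notin> V" using w(2) V(1) by (auto simp: frontier_def interior_open)
      have "w \<notin> D"
      proof
        assume "w \<in> D"
        then obtain e where e: "e > 0" "ball w e \<subseteq> U"
          using \<open>open U\<close> \<open>w \<in> ball z0 R\<close> open_contains_ball unfolding U_def by blast
        moreover obtain v where "v \<in> V" "dist v w < e"
          using wV(1) e(1) closure_approachable by blast
        ultimately have "ball w e \<subseteq> V" by (intro absorb[of _ v]) (auto simp: dist_commute)
        then show False using wV(2) e(1) by (meson centre_in_ball subsetD)
      qed
      moreover have "w \<in> closure D" using wV(1) V(3) closure_mono[of V D] by (auto simp: U_def)
      ultimately have "w \<in> F" using \<open>open D\<close> by (simp add: F_def frontier_def interior_open)
      have "0 < min \<epsilon> (dist w p / 2)" using w(1) \<epsilon> by (simp add: X_def)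
      then obtain x where x: "x \<in> V" "dist x w < min \<epsilon> (dist w p / 2)"
        using wV(1) closure_approachable by blast
      have "infdist x F \<le> dist x w" using \<open>w \<in> F\<close> by (rule infdist_le)
      moreover have "dist w p \<le> dist x w + dist x p"
        using dist_triangle[of w p x] by (simp add: dist_commute)
      moreover have "dist z0 x \<le> d + dist p w + dist x w"
        using dist_triangle[of z0 x p] dist_triangle[of p x w] dp by (simp add: dist_commute)
      moreover have "dist p w < \<epsilon>" using w(1) by (simp add: X_def)
      ultimately have "infdist x F < dist x p \<and> dist z0 x + infdist x F < R"
        using x(2) \<epsilon> by auto
      then show ?thesis using x(1) by blast
    qed
    then obtain x0 where x0: "x0 \<in> V" "infdist x0 F < dist x0 p" "dist z0 x0 + infdist x0 F < R" by blast
    define N where "N = V \<inter> {x. dist z0 x + infdist x F < R}"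
    have "open N" unfolding N_def by (intro open_Int V open_Collect_less continuous_intros)
    then obtain x j where x: "x \<in> N" "x \<in> D" "dist x (a j) = infdist x F"
      using dense[of N x0] x0 V(3) unfolding F_def N_def U_def by blast
    have aR: "a j \<in> ball z0 R" using x dist_triangle[of z0 "a j" x] by (auto simp: N_def)
    have seg: "a j + of_real t * (x - a j) \<in> V" if "0 < t" "t \<le> 1" for t
    proof -
      have "ball x (infdist x F) \<subseteq> D \<inter> ball z0 R"
      proof
        fix y assume y: "y \<in> ball x (infdist x F)"
        then have "y \<in> D" using ball_infdist_frontier_subset[OF x(2)] by (auto simp: F_def)
        moreover have "dist z0 y < R" using y x(1) dist_triangle[of z0 y x] by (auto simp: N_def)
        ultimately show "y \<in> D \<inter> ball z0 R" by simp
      qed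
      moreover have "x \<in> ball x (infdist x F)" using x aF FD by (auto simp flip: x(3))
      ultimately have sub: "ball x (infdist x F) \<subseteq> V"
        using x(1) by (intro absorb) (auto simp: U_def N_def)
      have "x - (a j + of_real t * (x - a j)) = of_real (1 - t) * (x - a j)" by (simp add: algebra_simps)
      then have "dist x (a j + of_real t * (x - a j)) = (1 - t) * dist x (a j)"
        using that by (simp add: dist_norm norm_mult del: of_real_diff)
      also have "\<dots> < 1 * dist x (a j)"
        using that x(2) aF[of j] FD by (intro mult_strict_right_mono) auto
      finally show ?thesis using sub x(3) by auto
    qed
    show False
    proof (rule pole_series_no_continuous_extension[OF c, where j = j and x = x and \<Phi> = \<Phi>])
      show "dist x (a j) \<le> dist x (a k)" for k unfolding x(3) by (rule infdist_le[OF aF])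
      show "x \<noteq> a j" using x(2) aF[of j] FD by auto
      show "isCont \<Phi> (a j)"
        using \<Phi> aR holomorphic_on_imp_continuous_on continuous_on_eq_continuous_at open_ball by blast
    qed (use eqV seg in \<open>auto simp: f_def\<close>)
  qed
  ultimately show "fps_conv_radius (fps_expansion (pole_series c a) z0) = (INF w\<in>frontier D. ereal (dist z0 w))"
    by (auto simp: f_def)
qed

section \<open>Graphs that are not complete pluripolar\<close>

text \<open>
  The poles are fixed first, then \<open>q\<close>, \<open>r\<close>, \<open>s\<close>, and the residues last, since their smallness depends
  on all of these. The contradiction is that a function whose -\<infinity> set is the graph over \<open>D1\<close> would
  also be -\<infinity> at a point over \<open>p\<close>, which does not belong to \<open>D1\<close>.
\<close>

theorem theorem1p1:
  fixes D1 D2 :: "complex set"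
  assumes "is_domain D1" and "is_domain D2" and "D1 \<subseteq> D2"
    and "\<exists>p\<in>D2. density_point p (D2 - D1)"
  shows "\<exists>f. f holomorphic_on D1 \<and> domain_of_existence D1 f \<and>
             \<not> complete_pluripolar (graph_over D1 f) (D2 \<times> UNIV)"
proof -
  obtain p where p: "p \<in> D2" "p islimpt frontier D1"
    using assms frontier_limit_point_exists by metis
  have op: "open D1" "open D2" using assms by (auto simp: is_domain_def)
  have pF: "p \<in> frontier D1" using p(2) closed_limpt[of "frontier D1"] frontier_closed by auto
  have FD: "frontier D1 \<inter> D1 = {}" using op by (auto simp: frontier_def interior_open)
  obtain a :: "nat \<Rightarrow> complex" where a: "\<And>n. a n \<in> frontier D1" "\<And>n. a n \<noteq> p"
    "\<And>N x. open N \<Longrightarrow> x \<in> N \<inter> D1 \<Longrightarrow> infdist x (frontier D1) < dist x p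
      \<Longrightarrow> \<exists>y\<in>N \<inter> D1. \<exists>n. dist y (a n) = infdist y (frontier D1)"
    using dense_nearest_frontier_points[OF op(1) p(2)] by metis
  obtain e where e: "e > 0" "ball p e \<subseteq> D2" using op p(1) open_contains_ball by blast
  define r where "r = e / 2"
  have "p \<in> closure D1" "r > 0" using pF e by (auto simp: frontier_def r_def)
  then obtain q where q: "q \<in> D1" "dist q p < r" using closure_approachable by blast
  have qr: "cball q r \<subseteq> D2"
  proof
    fix z assume "z \<in> cball q r"
    then have "z \<in> ball p e" using q(2) dist_triangle[of p z q] by (simp add: r_def dist_commute)
    then show "z \<in> D2" using e by blast
  qed
  obtain e' where e': "e' > 0" "cball q e' \<subseteq> D1" using op q(1) open_contains_cball by blast
  define s where "s = e' / 2"
  have far: "2 * s < dist q b" if "b \<in> frontier D1" for b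
    using e' FD that by (auto simp: s_def subset_iff not_le[symmetric])
  have s: "0 < s" "s < dist p q" "dist p q < r"
    using e' far[OF pF] q by (auto simp: s_def dist_commute)
  obtain c \<delta> \<rho> where w:
    "\<And>k. 0 < c k" "\<And>k. c k \<le> (1/2)^k" "\<And>k. c k \<le> \<rho> k * (1/2)^k" "\<And>k. 0 < \<rho> k" "\<And>k. 0 < \<delta> k"
    "\<And>k. \<delta> k * ln ((r + dist (a k) q) / dist p (a k)) \<le> ln (r / dist p q) * (1/2)^(k+2)"
    "\<And>k. \<delta> k * ln ((r + dist (a k) q) / \<rho> k) = ln (r / s)"
    using exists_small_pole_weights[where a = a and p = p and q = q and r = r and s = s] s a(2) by metis
  define f where "f = pole_series c a"
  have "summable c"
    by (rule summable_comparison_test'[of "\<lambda>k. (1/2)^k" 0])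
       (use w(1,2) in \<open>auto simp: summable_geometric less_imp_le abs_of_pos\<close>)
  then have dom: "domain_of_existence D1 f"
    unfolding f_def using assms(1) p(2) w(1) a by (intro pole_series_domain_of_existence) auto
  have "\<not> complete_pluripolar (graph_over D1 f) (D2 \<times> UNIV)"
  proof
    assume "complete_pluripolar (graph_over D1 f) (D2 \<times> UNIV)"
    then obtain u where psh: "plurisubharmonic_on (D2 \<times> UNIV) u"
      and u: "graph_over D1 f = {z \<in> D2 \<times> UNIV. u z = -\<infinity>}"
      unfolding complete_pluripolar_def by blast
    have "u (p, f p) = -\<infinity>"
      unfolding f_def
    proof (rule psh_minus_infinity_propagates[OF psh qr s w(1-3) w(4,5) w(6,7) a(2)])
      show "2 * s \<le> dist q (a k)" for k using far[OF a(1)] by (simp add: less_imp_le)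
      fix z assume "z \<in> sphere q s"
      then have "z \<in> D1" using e' by (auto simp: s_def)
      then have "(z, f z) \<in> graph_over D1 f" by (auto simp: graph_over_def)
      then show "u (z, pole_series c a z) = -\<infinity>" using u by (auto simp: f_def)
    qed
    then have "(p, f p) \<in> graph_over D1 f" using p(1) u by auto
    then have "p \<in> D1" by (auto simp: graph_over_def)
    then show False using pF FD by blast
  qed
  then show ?thesis using dom by (auto simp: domain_of_existence_def)
qed

end
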